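(* Let $q\ge 3$ be an integer, let $G=G_{n,1/2}$ be the binomial random graph on vertex set $[n]$ with edge probability $1/2$, and let $X_n$ be the number of partitions $\{A_1,\dots,A_q\}$ of $V(G)$ into $q$ sets (counted up to permutation of the parts) such that $d_{G[A_i]}(v)$ is divisible by $q$ for all $i\in[q]$ and all $v\in A_i$. If $q\ge 3$ is odd, then $X_n$ converges in distribution to $\mathrm{Po}(1/q!)$ as $n\to\infty$. If $q\ge 4$ is even, then $X_n$ converges in distribution to $\mathrm{Po}(2^q/q!)$ as $n\to\infty$.
   Context: $\mathrm{Po}(\lambda)$ denotes the Poisson distribution with mean $\lambda$. $G[A]$ denotes the subgraph of $G$ induced by $A$ and $d_H(v)$ the degree of $v$ in $H$. *)

theory Defs
  imports "HOL-Probability.Probability" "HOL-Library.Ramsey"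
begin

text \<open>
  A simple graph on a vertex set \<open>V\<close> is represented by its edge set \<open>E \<subseteq> [V]\<^bsup>2\<^esup>\<close>,
  a set of two-element subsets of \<open>V\<close>; the vertex set is passed separately where it matters.
\<close>

definition induced :: "'a set set \<Rightarrow> 'a set \<Rightarrow> 'a set set" where
  "induced E A = {e \<in> E. e \<subseteq> A}"

definition vdegree :: "'a set set \<Rightarrow> 'a \<Rightarrow> nat" where
  "vdegree E v = card {e \<in> E. v \<in> e}"

text \<open>
  Each potential edge gets an independent Bernoulli indicator; indices outside \<open>[{1..n}]\<^bsup>2\<^esup>\<close>
  carry the default value \<open>False\<close>.  For \<open>p\<close> outside \<open>[0, 1]\<close> the value is meaningless, since
  \<^const>\<open>bernoulli_pmf\<close> then clips its parameter.
\<close>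

definition binomial_random_graph :: "nat \<Rightarrow> real \<Rightarrow> nat set set pmf" where
  "binomial_random_graph n p =
     map_pmf (\<lambda>\<omega>. {e \<in> [{1..n}]\<^bsup>2\<^esup>. \<omega> e}) (Pi_pmf ([{1..n}]\<^bsup>2\<^esup>) False (\<lambda>_. bernoulli_pmf p))"

text \<open>
  Partitions are sets of parts, hence counted up to permutation of the parts; as usual for
  partitions (\<^const>\<open>partition_on\<close>), parts are nonempty.
\<close>

definition divisible_partitions :: "nat \<Rightarrow> 'a set \<Rightarrow> 'a set set \<Rightarrow> 'a set set set" where
  "divisible_partitions q V E =
     {P. partition_on V P \<and> card P = q \<and> (\<forall>A\<in>P. \<forall>v\<in>A. q dvd vdegree (induced E A) v)}"

definition num_divisible_partitions :: "nat \<Rightarrow> nat \<Rightarrow> nat set set \<Rightarrow> nat" where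
  "num_divisible_partitions q n E = card (divisible_partitions q {1..n} E)"

text \<open>
  Convergence in distribution of natural-number valued random variables \<open>X n\<close>, each defined on its
  own discrete probability space \<open>M n\<close>, to a distribution on the natural numbers.
\<close>

definition converges_in_distribution ::
  "(nat \<Rightarrow> 'a pmf) \<Rightarrow> (nat \<Rightarrow> 'a \<Rightarrow> nat) \<Rightarrow> nat pmf \<Rightarrow> bool" where
  "converges_in_distribution M X D \<longleftrightarrow>
     weak_conv_m (\<lambda>n. distr (measure_pmf (M n)) borel (\<lambda>\<omega>. real (X n \<omega>)))
                 (distr (measure_pmf D) borel real)"

end

theory Submission
  imports Defs "HOL-Number_Theory.Cong" "HOL-Real_Asymp.Real_Asymp"
begin

text \<open>
  By the Bonferroni inequalities it suffices to show \<open>E (X\<^sub>n choose k) \<longlonglongrightarrow> \<lambda>\<^sup>k / k!\<close> for every \<open>k\<close>. Up to the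
  factor \<open>k! (q!)\<^sup>k\<close> this expectation is a sum over \<open>k\<close>-tuples of colourings of the probability that all
  of them are good. Expanding the divisibility conditions with characters of \<open>\<int>/q\<close> gives every vertex
  a type \<open>(g, x)\<close>, with \<open>g \<in> [q]\<^sup>k\<close> its colours and \<open>x \<in> (\<int>/q)\<^sup>k\<close> its frequencies, and turns the expectation into
  \<open>q\<^bsup>-kn\<^esup>\<close> times the sum over all assignments of types to the vertices of
  \<open>\<Prod>\<^bsub>u<v\<^esub> (1 + \<omega>\<^bsup>s(u,v)\<^esup>) / 2\<close>, where \<open>s(u,v)\<close> sums \<open>x\<^sub>j(u) + x\<^sub>j(v)\<close> over the colourings \<open>j\<close> in which
  \<open>u\<close> and \<open>v\<close> have the same colour.

  Two types are compatible if \<open>q\<close> divides \<open>s\<close>; each incompatible pair of vertices costs a constant factor less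
  than one. Hence only assignments into a clique \<open>L\<close> of pairwise compatible types matter. A Kraft-type
  injection into \<open>[q]\<^sup>k\<close> shows \<open>|L| \<le> q\<^sup>k\<close>, so the expectation tends to the number of cliques of size
  exactly \<open>q\<^sup>k\<close>, counting only those in which no two coordinates induce the same partition. Such a clique is
  the graph of \<open>g \<mapsto> (f\<^sub>j (g\<^sub>j))\<^sub>j\<close> for functions \<open>f\<^sub>j\<close> with \<open>2 f\<^sub>j = 0\<close> in \<open>\<int>/q\<close>; there is one choice for \<open>q\<close> odd,
  and there are \<open>2\<^bsup>qk\<^esup>\<close> for \<open>q\<close> even.
\<close>

section \<open>Convergence to the Poisson distribution from factorial moments\<close>

text \<open>A Bonferroni inequality for "exactly \<open>m\<close>". The identity \<open>ch\<close>
  pulls out the factor \<open>x choose m\<close> and leaves an alternating sum along row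
  \<open>x - m\<close> of Pascal's triangle. Cut off after \<open>J\<close> terms, such a sum
  collapses by Pascal's rule to a single binomial coefficient of the row above, which the first
  omitted term dominates.\<close>

lemma binomial_indicator_remainder:
  fixes x m J :: nat
  shows "\<bar>of_bool (x = m) - (\<Sum>j<J. (-1) ^ j * real ((m + j) choose m) * real (x choose (m + j)))\<bar>
           \<le> real ((m + J) choose m) * real (x choose (m + J))"
proof -
  have ch: "real ((m + j) choose m) * real (x choose (m + j)) = real (x choose m) * real ((x - m) choose j)" for j
  proof (cases "m + j \<le> x")
    case True
    have "(x choose (m + j)) * ((m + j) choose m) = (x choose m) * ((x - m) choose (m + j - m))"
      by (rule choose_mult) (use True in auto)
    thus ?thesis by (metis add_diff_cancel_left' mult.commute of_nat_mult)
  next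
    case False
    hence "x choose (m + j) = 0" "x < m \<or> x - m < j" by (auto simp: binomial_eq_0)
    thus ?thesis by (auto simp: binomial_eq_0)
  qed
  have S: "(\<Sum>j<J. (-1) ^ j * real ((m + j) choose m) * real (x choose (m + j)))
          = real (x choose m) * (\<Sum>j<J. (-1) ^ j * real ((x - m) choose j))"
    unfolding sum_distrib_left by (intro sum.cong refl) (use ch in \<open>simp add: mult_ac\<close>)
  consider "x < m" | "x = m" | y where "x = m + Suc y"
    by (metis add_Suc_right less_imp_Suc_add linorder_neqE_nat)
  thus ?thesis
  proof cases
    case 1
    thus ?thesis by (simp add: binomial_eq_0)
  next
    case 2
    have "(\<Sum>j<J. (-1) ^ j * real ((x - m) choose j)) = of_bool (J > 0)"
      using 2 by (induction J) auto
    thus ?thesis using 2 S by (cases J) auto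
  next
    case 3
    have alt: "(\<Sum>j<Suc i. (-1) ^ j * real (Suc y choose j)) = (-1) ^ i * real (y choose i)" for i
      by (induction i) (auto simp: algebra_simps)
    show ?thesis
    proof (cases J)
      case 0
      then show ?thesis using 3 by simp
    next
      case (Suc i)
      have "\<bar>of_bool (x = m) - (\<Sum>j<J. (-1) ^ j * real ((m + j) choose m) * real (x choose (m + j)))\<bar>
            = real (x choose m) * real (y choose i)"
        unfolding S using 3 alt[of i] Suc by (simp add: abs_mult power_abs)
      also have "\<dots> \<le> real (x choose m) * real ((x - m) choose J)"
        using 3 Suc by (intro mult_left_mono) auto
      finally show ?thesis using ch[of J] by simp
    qed
  qed
qed

text \<open>The two limits are taken in turn. For fixed \<open>J\<close>, the truncated Bonferroni
  sum \<open>S n J\<close> tends to \<open>T J\<close>, and its error is at most a multiple of a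
  factorial moment whose limit is a single term of an exponential series. That term is small for
  large \<open>J\<close>, so \<open>J\<close> is chosen first and \<open>n\<close>
  afterwards.\<close>

lemma pmf_convergence_from_factorial_moments:
  fixes p :: "nat \<Rightarrow> 'a pmf" and X :: "nat \<Rightarrow> 'a \<Rightarrow> nat" and l :: real
  assumes fin: "\<And>n. finite (set_pmf (p n))"
    and mom: "\<And>k. (\<lambda>n. measure_pmf.expectation (p n) (\<lambda>w. real (X n w choose k))) \<longlonglongrightarrow> l ^ k / fact k"
  shows "(\<lambda>n. measure_pmf.prob (p n) {w. X n w = m}) \<longlonglongrightarrow> l ^ m / fact m * exp (- l)"
proof -
  let ?B = "\<lambda>n k. measure_pmf.expectation (p n) (\<lambda>w. real (X n w choose k))"
  define S where "S n J = (\<Sum>j<J. (-1) ^ j * real ((m + j) choose m) * ?B n (m + j))" for n J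
  define T where "T J = (\<Sum>j<J. (-1) ^ j * real ((m + j) choose m) * (l ^ (m + j) / fact (m + j)))" for J
  have int [simp]: "integrable (measure_pmf (p n)) f" for n and f :: "'a \<Rightarrow> real"
    by (rule integrable_measure_pmf_finite[OF fin])
  have bound: "\<bar>measure_pmf.prob (p n) {w. X n w = m} - S n J\<bar> \<le> real ((m + J) choose m) * ?B n (m + J)" for n J
  proof -
    let ?f = "\<lambda>w. of_bool (X n w = m) - (\<Sum>j<J. (-1) ^ j * real ((m + j) choose m) * real (X n w choose (m + j))) :: real"
    have "measure_pmf.prob (p n) {w. X n w = m} = measure_pmf.expectation (p n) (\<lambda>w. of_bool (X n w = m))"
    proof -
      have "(\<lambda>w. of_bool (X n w = m)) = (indicator {w. X n w = m} :: 'a \<Rightarrow> real)"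
        by (rule ext) (simp add: indicator_def)
      thus ?thesis by (simp only: Bochner_Integration.integral_indicator) simp
    qed
    hence "\<bar>measure_pmf.prob (p n) {w. X n w = m} - S n J\<bar> = \<bar>measure_pmf.expectation (p n) ?f\<bar>"
      by (simp add: S_def Bochner_Integration.integral_sum Bochner_Integration.integral_diff)
    also have "\<dots> \<le> measure_pmf.expectation (p n) (\<lambda>w. \<bar>?f w\<bar>)"
      by (rule integral_abs_bound)
    also have "\<dots> \<le> measure_pmf.expectation (p n) (\<lambda>w. real ((m + J) choose m) * real (X n w choose (m + J)))"
      by (intro integral_mono int binomial_indicator_remainder)
    finally show ?thesis by simp
  qed
  \<comment> \<open>With \<open>m\<close> fixed, this identity turns both the main terms and the
    remainder into \<open>l ^ m / fact m\<close> times terms of the exponential series.\<close>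
  have c: "real ((m + j) choose m) * (l ^ (m + j) / fact (m + j)) = l ^ m / fact m * (l ^ j / fact j)" for j
    by (simp add: binomial_fact power_add field_simps)
  have T: "T \<longlonglongrightarrow> l ^ m / fact m * exp (- l)"
  proof -
    have "T = (\<lambda>J. l ^ m / fact m * (\<Sum>j<J. (-l) ^ j / fact j))"
    proof
      fix J show "T J = l ^ m / fact m * (\<Sum>j<J. (-l) ^ j / fact j)"
        unfolding T_def sum_distrib_left
      proof (intro sum.cong refl)
        fix j
        have "(-1) ^ j * real ((m + j) choose m) * (l ^ (m + j) / fact (m + j))
             = (-1) ^ j * (l ^ m / fact m * (l ^ j / fact j))" using c[of j] by (simp only: mult.assoc)
        also have "\<dots> = l ^ m / fact m * ((-l) ^ j / fact j)"
          by (subst (2) power_minus) simp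
        finally show "(-1) ^ j * real ((m + j) choose m) * (l ^ (m + j) / fact (m + j))
          = l ^ m / fact m * ((-l) ^ j / fact j)" .
      qed
    qed
    moreover have "(\<lambda>J. \<Sum>j<J. (-l) ^ j / fact j) \<longlonglongrightarrow> exp (-l)"
      using exp_converges[of "-l"] by (simp add: sums_def divide_inverse mult.commute)
    ultimately show ?thesis by (simp only:) (intro tendsto_mult tendsto_const)
  qed
  have R: "(\<lambda>J. l ^ m / fact m * (l ^ J / fact J)) \<longlonglongrightarrow> 0"
    using summable_LIMSEQ_zero[OF summable_exp[of l]] by (intro tendsto_mult_right_zero) (simp add: divide_inverse mult.commute)
  have Sn: "(\<lambda>n. S n J) \<longlonglongrightarrow> T J" for J
    unfolding S_def T_def by (intro tendsto_intros mom)
  show ?thesis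
  proof (rule LIMSEQ_I)
    fix e :: real assume e: "e > 0"
    have "\<forall>\<^sub>F J in sequentially. \<bar>T J - l ^ m / fact m * exp (- l)\<bar> < e / 3 \<and> l ^ m / fact m * (l ^ J / fact J) < e / 3"
      using tendstoD[OF T, of "e / 3"] order_tendstoD(2)[OF R, of "e / 3"] e
      by (auto simp: dist_real_def eventually_conj_iff)
    then obtain J where J: "\<bar>T J - l ^ m / fact m * exp (- l)\<bar> < e / 3" "l ^ m / fact m * (l ^ J / fact J) < e / 3"
      by (auto simp: eventually_sequentially)
    have "(\<lambda>n. real ((m + J) choose m) * ?B n (m + J)) \<longlonglongrightarrow> l ^ m / fact m * (l ^ J / fact J)"
      unfolding c[symmetric] by (intro tendsto_intros mom)
    hence "\<forall>\<^sub>F n in sequentially. real ((m + J) choose m) * ?B n (m + J) < e / 3 \<and> \<bar>S n J - T J\<bar> < e / 3"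
      using order_tendstoD(2)[of _ "l ^ m / fact m * (l ^ J / fact J)" sequentially "e / 3"] J(2) tendstoD[OF Sn[of J], of "e / 3"] e
      by (auto simp: dist_real_def eventually_conj_iff)
    then obtain N where N: "\<And>n. n \<ge> N \<Longrightarrow> real ((m + J) choose m) * ?B n (m + J) < e / 3 \<and> \<bar>S n J - T J\<bar> < e / 3"
      by (auto simp: eventually_sequentially)
    show "\<exists>no. \<forall>n\<ge>no. norm (measure_pmf.prob (p n) {w. X n w = m} - l ^ m / fact m * exp (- l)) < e"
    proof (intro exI allI impI)
      fix n assume "n \<ge> N"
      thus "norm (measure_pmf.prob (p n) {w. X n w = m} - l ^ m / fact m * exp (- l)) < e"
        using N[of n] bound[of n J] J unfolding real_norm_def by linarith
    qed
  qed
qed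

text \<open>On the natural numbers, the distribution function at \<open>x\<close> is a finite sum of
  point masses, so it converges at every \<open>x\<close>, whether or not \<open>x\<close> is a
  continuity point.\<close>

lemma converges_in_distributionI:
  fixes p :: "nat \<Rightarrow> 'a pmf" and X :: "nat \<Rightarrow> 'a \<Rightarrow> nat" and D :: "nat pmf"
  assumes "\<And>m. (\<lambda>n. measure_pmf.prob (p n) {w. X n w = m}) \<longlonglongrightarrow> pmf D m"
  shows "converges_in_distribution p X D"
  unfolding converges_in_distribution_def weak_conv_m_def weak_conv_def
proof (intro allI impI)
  fix x :: real
  have *: "cdf (distr (measure_pmf r) borel (\<lambda>w. real (Y w))) x
        = (\<Sum>m | real m \<le> x. measure_pmf.prob r {w. Y w = m})" for r :: "'b pmf" and Y
  proof -
    have fin: "finite {m. real m \<le> x}"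
      by (rule finite_subset[of _ "{..nat \<lfloor>x\<rfloor>}"]) (auto simp: le_nat_floor)
    have "cdf (distr (measure_pmf r) borel (\<lambda>w. real (Y w))) x = measure_pmf.prob r {w. real (Y w) \<le> x}"
      unfolding cdf_def by (subst measure_distr) (auto intro!: arg_cong2[where f = measure])
    also have "{w. real (Y w) \<le> x} = (\<Union>m\<in>{m. real m \<le> x}. {w. Y w = m})" by auto
    also have "measure_pmf.prob r \<dots> = (\<Sum>m | real m \<le> x. measure_pmf.prob r {w. Y w = m})"
      by (rule measure_pmf.finite_measure_finite_Union[OF fin]) (auto simp: disjoint_family_on_def)
    finally show ?thesis .
  qed
  have D: "pmf D m = measure_pmf.prob D {w. w = m}" for m by (simp add: pmf.rep_eq)
  show "(\<lambda>n. cdf (distr (measure_pmf (p n)) borel (\<lambda>\<omega>. real (X n \<omega>))) x)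
     \<longlonglongrightarrow> cdf (distr (measure_pmf D) borel real) x"
    unfolding * using assms unfolding D by (intro tendsto_sum) auto
qed

lemma converges_in_distribution_poissonI:
  fixes p :: "nat \<Rightarrow> 'a pmf" and X :: "nat \<Rightarrow> 'a \<Rightarrow> nat" and l :: real
  assumes "\<And>n. finite (set_pmf (p n))" "l > 0"
    and "\<And>k. (\<lambda>n. measure_pmf.expectation (p n) (\<lambda>w. real (X n w choose k))) \<longlonglongrightarrow> l ^ k / fact k"
  shows "converges_in_distribution p X (poisson_pmf l)"
proof (rule converges_in_distributionI)
  fix m
  show "(\<lambda>n. measure_pmf.prob (p n) {w. X n w = m}) \<longlonglongrightarrow> pmf (poisson_pmf l) m"
    unfolding pmf_poisson[OF assms(2)] using assms by (intro pmf_convergence_from_factorial_moments) auto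
qed

section \<open>Cliques of vertex types\<close>

text \<open>Holds both the colour vectors and the label vectors, the latter as least residues modulo
  \<open>q\<close>. Extensionality makes the set finite and lets the coordinates below
  \<open>k\<close> decide equality.\<close>

definition tuples :: "nat \<Rightarrow> nat \<Rightarrow> (nat \<Rightarrow> nat) set" where
  "tuples q k = {..<k} \<rightarrow>\<^sub>E {..<q}"

type_synonym vtype = "(nat \<Rightarrow> nat) \<times> (nat \<Rightarrow> nat)"

definition agree :: "nat \<Rightarrow> (nat \<Rightarrow> nat) \<Rightarrow> (nat \<Rightarrow> nat) \<Rightarrow> nat set" where
  "agree k g h = {j. j < k \<and> g j = h j}"

definition phase :: "nat \<Rightarrow> vtype \<Rightarrow> vtype \<Rightarrow> nat" where
  "phase k s t = (\<Sum>j\<in>agree k (fst s) (fst t). snd s j + snd t j)"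

text \<open>What remains of pairwise compatibility once the labels of \<open>t\<close> are
  cancelled: two labels over the same colour vector have the same inner product modulo
  \<open>q\<close> with every agreement vector. Labels over different colour vectors are not
  compared, which makes the notion robust enough to survive adding a vertex that is incompatible
  with itself.\<close>

definition separated :: "nat \<Rightarrow> nat \<Rightarrow> vtype set \<Rightarrow> bool" where
  "separated q k L \<longleftrightarrow> (\<forall>s\<in>L. \<forall>s'\<in>L. \<forall>t\<in>L. fst s = fst s' \<longrightarrow>
     [(\<Sum>j\<in>agree k (fst s) (fst t). snd s j) = (\<Sum>j\<in>agree k (fst s) (fst t). snd s' j)] (mod q))"

text \<open>The colour vectors of \<open>L\<close> are read as paths in a prefix tree. The condition
  says that the node reached by the first \<open>j\<close> colours of \<open>g\<close> has at least
  two children.\<close>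

definition branches :: "vtype set \<Rightarrow> (nat \<Rightarrow> nat) \<Rightarrow> nat \<Rightarrow> bool" where
  "branches L g j \<longleftrightarrow> (\<exists>s\<in>L. \<exists>t\<in>L. (\<forall>i<j. fst s i = g i) \<and> (\<forall>i<j. fst t i = g i) \<and> fst s j \<noteq> fst t j)"

text \<open>Kraft-type code: colours are decoded from left to right, a non-branching one being determined by
  its predecessors, and then labels from right to left, a branching one being determined modulo \<open>q\<close> by
  orthogonality to an agreement vector.\<close>

definition encode :: "nat \<Rightarrow> vtype set \<Rightarrow> vtype \<Rightarrow> nat \<Rightarrow> nat" where
  "encode k L s = (\<lambda>j\<in>{..<k}. if branches L (fst s) j then fst s j else snd s j)"

section \<open>The Kraft-type bound for separated sets and for cliques\<close>

lemma finite_agree [simp]: "finite (agree k g h)"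
  by (simp add: agree_def)

lemma finite_tuples [simp]: "finite (tuples q k)"
  by (simp add: tuples_def finite_PiE)

lemma card_tuples [simp]: "card (tuples q k) = q ^ k"
  by (simp add: tuples_def card_funcsetE)

lemma tuples_upd: "g \<in> tuples q k \<Longrightarrow> j < k \<Longrightarrow> a < q \<Longrightarrow> g(j := a) \<in> tuples q k"
  by (auto simp: tuples_def PiE_def Pi_def extensional_def)

lemma tuples_lt: "g \<in> tuples q k \<Longrightarrow> j < k \<Longrightarrow> g j < q"
  by (auto simp: tuples_def)

lemma tuples_eqI: "g \<in> tuples q k \<Longrightarrow> h \<in> tuples q k \<Longrightarrow> (\<And>j. j < k \<Longrightarrow> g j = h j) \<Longrightarrow> g = h"
  unfolding tuples_def by (rule PiE_ext) auto

lemma phase_commute: "phase k s t = phase k t s"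
proof -
  have "agree k (fst s) (fst t) = agree k (fst t) (fst s)" by (auto simp: agree_def)
  thus ?thesis unfolding phase_def by (auto intro!: sum.cong)
qed

lemma branches_cong: "(\<And>i. i < j \<Longrightarrow> g i = h i) \<Longrightarrow> branches L g j = branches L h j"
  by (simp add: branches_def)

lemma encode_in_tuples:
  assumes "s \<in> tuples q k \<times> tuples q k"
  shows "encode k L s \<in> tuples q k"
  unfolding tuples_def
proof (rule PiE_I)
  fix j assume "j \<in> {..<k}"
  thus "encode k L s j \<in> {..<q}"
    using assms tuples_lt[of "fst s" q k j] tuples_lt[of "snd s" q k j] by (auto simp: encode_def)
qed (simp add: encode_def)

text \<open>At a node with a single child the next colour is forced, so only the branching entries
  of the code have to be compared. Hence an entry at a non-branching coordinate can be changed
  without affecting the colours.\<close>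

lemma encode_prefix:
  assumes "s \<in> L" "t \<in> L" "m \<le> k"
    and enc: "\<And>i. i < m \<Longrightarrow> branches L (fst s) i \<Longrightarrow> encode k L s i = encode k L t i"
  shows "i < m \<Longrightarrow> fst s i = fst t i"
proof (induction i rule: less_induct)
  case (less i)
  have IH: "\<And>i'. i' < i \<Longrightarrow> fst s i' = fst t i'" using less by auto
  hence b: "branches L (fst s) i = branches L (fst t) i" by (rule branches_cong)
  show ?case
  proof (cases "branches L (fst s) i")
    case True
    thus ?thesis using enc[OF less.prems] b less.prems assms(3) by (simp add: encode_def)
  next
    case False
    thus ?thesis using assms(1,2) IH by (metis branches_def)
  qed
qed

text \<open>Labels are recovered from the last coordinate down. At a branching \<open>i\<close> some
  \<open>u\<close> in \<open>L\<close> follows \<open>s\<close> up to \<open>i\<close> and leaves it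
  there. Subtracting the relation for the agreement set with \<open>u\<close> from the relation for
  all coordinates leaves the label at \<open>i\<close> and later labels, which are already known to
  coincide. So the labels at \<open>i\<close> are congruent, and being less than \<open>q\<close>
  they are equal.\<close>

lemma encode_suffix:
  assumes sep: "separated q k L" and L: "L \<subseteq> tuples q k \<times> tuples q k"
    and st: "s \<in> L" "t \<in> L" "fst s = fst t"
    and enc: "\<And>i. m \<le> i \<Longrightarrow> i < k \<Longrightarrow> encode k L s i = encode k L t i"
  shows "m \<le> i \<Longrightarrow> i < k \<Longrightarrow> snd s i = snd t i"
proof (induction "k - i" arbitrary: i rule: less_induct)
  case less
  have IH: "snd s i' = snd t i'" if "i < i'" "i' < k" for i'
    using less.hyps[of i'] less.prems that by auto
  have e: "encode k L s i = encode k L t i" by (rule enc[OF less.prems])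
  show ?case
  proof (cases "branches L (fst s) i")
    case False
    thus ?thesis using e less.prems st(3) by (simp add: encode_def)
  next
    case True
    then obtain u where u: "u \<in> L" "\<forall>j<i. fst u j = fst s j" "fst u i \<noteq> fst s i"
      unfolding branches_def by metis
    define A where "A = agree k (fst s) (fst u)"
    define D where "D = {..<k} - A - {i}"
    have full: "{..<k} = insert i (D \<union> A)" "i \<notin> D \<union> A" "D \<inter> A = {}" "finite D" "finite A"
      using u less.prems by (auto simp: D_def A_def agree_def)
    have D: "j > i" "j < k" if "j \<in> D" for j
      using that u by (auto simp: D_def A_def agree_def) (metis linorder_neqE_nat)+
    have a: "agree k (fst s) (fst s) = {..<k}" by (auto simp: agree_def)
    have c1: "[(\<Sum>j<k. snd s j) = (\<Sum>j<k. snd t j)] (mod q)"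
      using sep st a unfolding separated_def by metis
    have c2: "[(\<Sum>j\<in>A. snd s j) = (\<Sum>j\<in>A. snd t j)] (mod q)"
      using sep st u unfolding separated_def A_def by metis
    have Deq: "(\<Sum>j\<in>D. snd s j) = (\<Sum>j\<in>D. snd t j)"
      by (intro sum.cong refl IH D)
    have sum: "(\<Sum>j<k. f j) = f i + ((\<Sum>j\<in>D. f j) + (\<Sum>j\<in>A. f j))" for f :: "nat \<Rightarrow> nat"
      unfolding full(1) using full(2-) by (simp add: sum.union_disjoint)
    have "[snd s i + ((\<Sum>j\<in>D. snd s j) + (\<Sum>j\<in>A. snd s j)) = snd t i + ((\<Sum>j\<in>D. snd t j) + (\<Sum>j\<in>A. snd t j))] (mod q)"
      using c1 unfolding sum .
    moreover have "[(\<Sum>j\<in>D. snd s j) + (\<Sum>j\<in>A. snd s j) = (\<Sum>j\<in>D. snd t j) + (\<Sum>j\<in>A. snd t j)] (mod q)"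
      unfolding Deq by (rule cong_add[OF cong_refl c2])
    note cong_add[OF cong_refl[of "snd t i"] cong_sym[OF this]]
    ultimately have "[snd s i + ((\<Sum>j\<in>D. snd s j) + (\<Sum>j\<in>A. snd s j)) = snd t i + ((\<Sum>j\<in>D. snd s j) + (\<Sum>j\<in>A. snd s j))] (mod q)"
      by (rule cong_trans)
    hence "[snd s i = snd t i] (mod q)"
      by (simp only: cong_add_rcancel_nat)
    moreover have "snd s i < q" "snd t i < q"
      using st L less.prems tuples_lt[of "snd s" q k i] tuples_lt[of "snd t" q k i] by auto
    ultimately show ?thesis by (simp add: cong_def)
  qed
qed

lemma inj_on_encode:
  assumes sep: "separated q k L" and L: "L \<subseteq> tuples q k \<times> tuples q k"
  shows "inj_on (encode k L) L"
proof (rule inj_onI)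
  fix s t assume st: "s \<in> L" "t \<in> L" "encode k L s = encode k L t"
  have "fst s = fst t"
    by (rule tuples_eqI[of _ q k]) (use st L encode_prefix[of s L t k k] in auto)
  moreover have "snd s = snd t"
    by (rule tuples_eqI[of _ q k]) (use st L encode_suffix[OF sep L st(1,2) calculation, of 0] in auto)
  ultimately show "s = t" by (simp add: prod_eq_iff)
qed

lemma card_separated_le:
  assumes "separated q k L" "L \<subseteq> tuples q k \<times> tuples q k"
  shows "card L \<le> q ^ k"
proof -
  have "card L \<le> card (tuples q k)"
    by (rule card_inj_on_le[OF inj_on_encode[OF assms]])
       (use assms(2) in \<open>auto intro!: encode_in_tuples\<close>)
  thus ?thesis by simp
qed

text \<open>Equality in the Kraft-type bound makes every word a codeword. The structure of maximum
  cliques is derived by editing single entries of codewords and decoding the result.\<close>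

lemma encode_surj:
  assumes "separated q k L" "L \<subseteq> tuples q k \<times> tuples q k" "card L = q ^ k"
  shows "encode k L ` L = tuples q k"
proof (rule card_subset_eq)
  show "encode k L ` L \<subseteq> tuples q k" using assms(2) by (auto intro!: encode_in_tuples)
  show "card (encode k L ` L) = card (tuples q k)"
    using card_image[OF inj_on_encode[OF assms(1,2)]] assms(3) by simp
qed simp

lemma cong_dvd_add_cancel:
  fixes a b c q :: nat
  assumes "q dvd a + c" "q dvd b + c" shows "[a = b] (mod q)"
  proof -
  have "[a + c = b + c] (mod q)" using assms by (simp add: cong_def dvd_eq_mod_eq_0)
  thus ?thesis by (simp only: cong_add_rcancel_nat)
qed

lemma compat_imp_cong:
  assumes "q dvd phase k s t" "q dvd phase k s' t" "fst s = fst s'"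
  shows "[(\<Sum>j\<in>agree k (fst s) (fst t). snd s j) = (\<Sum>j\<in>agree k (fst s) (fst t). snd s' j)] (mod q)"
  using assms by (intro cong_dvd_add_cancel[of _ _ "\<Sum>j\<in>agree k (fst s) (fst t). snd t j"])
                 (simp_all add: phase_def sum.distrib)

lemma clique_separated:
  assumes "\<And>s t. s \<in> L \<Longrightarrow> t \<in> L \<Longrightarrow> q dvd phase k s t"
  shows "separated q k L"
  unfolding separated_def by (intro ballI impI compat_imp_cong assms)

lemma card_clique_le:
  assumes "\<And>s t. s \<in> L \<Longrightarrow> t \<in> L \<Longrightarrow> q dvd phase k s t" "L \<subseteq> tuples q k \<times> tuples q k"
  shows "card L \<le> q ^ k"
  using card_separated_le[OF clique_separated] assms by blast

text \<open>A vertex \<open>t\<close> compatible with all of \<open>L\<close> leaves \<open>insert t L\<close> separated even if \<open>t\<close> is not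
  compatible with itself.\<close>

lemma maximum_clique_dominates:
  assumes cl: "\<And>s t. s \<in> L \<Longrightarrow> t \<in> L \<Longrightarrow> q dvd phase k s t"
    and L: "L \<subseteq> tuples q k \<times> tuples q k" and card: "card L = q ^ k"
    and t: "t \<in> tuples q k \<times> tuples q k - L"
  shows "\<exists>s\<in>L. \<not> q dvd phase k t s"
proof (rule ccontr)
  assume "\<not> ?thesis"
  hence all: "q dvd phase k t s" "q dvd phase k s t" if "s \<in> L" for s
    using that phase_commute by metis+
  have "separated q k (insert t L)"
    unfolding separated_def
  proof (intro ballI impI)
    fix s s' u assume *: "s \<in> insert t L" "s' \<in> insert t L" "u \<in> insert t L" "fst s = fst s'"
    show "[(\<Sum>j\<in>agree k (fst s) (fst u). snd s j) = (\<Sum>j\<in>agree k (fst s) (fst u). snd s' j)] (mod q)"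
    proof (cases "u \<in> L")
      case True
      have "q dvd phase k v u" if "v \<in> insert t L" for v
        using that all(1)[OF True] cl[OF _ True] by blast
      thus ?thesis using * by (intro compat_imp_cong) blast+
    next
      case False
      hence u: "u = t" using * by auto
      show ?thesis
      proof (cases "s \<in> L \<and> s' \<in> L")
        case True
        thus ?thesis using * all(2) u by (intro compat_imp_cong) blast+
      next
        case False
        \<comment> \<open>One of \<open>s\<close> and \<open>s'\<close> is \<open>t\<close>. If they
          differ, the other one lies in \<open>L\<close> and has the colours of \<open>t\<close>;
          agreement sets depend on colours only, so it can replace \<open>u\<close> and the previous
          argument applies to it.\<close>
        hence "s = s' \<or> (\<exists>v\<in>L. fst v = fst t)" "fst s = fst t" using * by auto
        thus ?thesis
        proof (elim disjE bexE)
          fix v assume v: "v \<in> L" "fst v = fst t"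
          have "[(\<Sum>j\<in>agree k (fst s) (fst v). snd s j) = (\<Sum>j\<in>agree k (fst s) (fst v). snd s' j)] (mod q)"
            
          proof -
            have "q dvd phase k w v" if "w \<in> insert t L" for w
              using that all(1)[OF v(1)] cl[OF _ v(1)] by blast
            thus ?thesis using * by (intro compat_imp_cong) blast+
          qed
          thus ?thesis using u v by simp
        qed auto
      qed
    qed
  qed
  hence "card (insert t L) \<le> q ^ k" by (rule card_separated_le) (use L t in auto)
  moreover have "finite L" using L by (rule finite_subset) auto
  ultimately show False using card t by simp
qed

section \<open>Maximum cliques whose coordinates induce distinct partitions\<close>

definition resolving :: "nat \<Rightarrow> vtype set \<Rightarrow> bool" where
  "resolving k L \<longleftrightarrow> (\<forall>i<k. \<forall>j<k. i \<noteq> j \<longrightarrow>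
     (\<exists>s\<in>L. \<exists>t\<in>L. (fst s i = fst t i) \<noteq> (fst s j = fst t j)))"

text \<open>At a branching node the codeword stores the colour itself. Overwriting that entry by
  \<open>a\<close> gives another codeword, whose earlier entries still decode to the same
  path.\<close>

lemma branch_attains:
  assumes sep: "separated q k L" and L: "L \<subseteq> tuples q k \<times> tuples q k" and card: "card L = q ^ k"
    and b: "branches L p j" and j: "j < k" and a: "a < q"
  shows "\<exists>s\<in>L. (\<forall>i<j. fst s i = p i) \<and> fst s j = a"
proof -
  obtain s where s: "s \<in> L" "\<forall>i<j. fst s i = p i" using b by (auto simp: branches_def)
  have bs: "branches L (fst s) j" using b branches_cong[of j "fst s" p L] s by simp
  have "(encode k L s)(j := a) \<in> tuples q k"
    by (rule tuples_upd[OF encode_in_tuples]) (use s L j a in auto)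
  then obtain t where t: "t \<in> L" "encode k L t = (encode k L s)(j := a)"
    using encode_surj[OF sep L card] by (metis imageE)
  have pre: "fst s i = fst t i" if "i < j" for i
    using encode_prefix[of s L t j k] s t j that by auto
  hence "branches L (fst t) j" using bs branches_cong by metis
  moreover have "encode k L t j = a" using t by simp
  ultimately have "fst t j = a" using j by (simp add: encode_def)
  thus ?thesis using t s pre by auto
qed

text \<open>Two elements of the fibre over the same colour vector whose labels differ by one at the
  non-branching coordinate \<open>j\<close> yield a vector orthogonal to all agreement vectors. Since every subset of
  the earlier coordinates is an agreement set, \<open>q \<ge> 3\<close> forces this vector to be \<open>e\<^sub>j - e\<^sub>i\<close>.\<close>

lemma nonbranching_coordinate:
  assumes q: "q \<ge> 3" and sep: "separated q k L" and L: "L \<subseteq> tuples q k \<times> tuples q k"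
    and card: "card L = q ^ k" and j: "j < k" and p: "p \<in> tuples q k"
    and full: "\<And>p. p \<in> tuples q k \<Longrightarrow> \<exists>s\<in>L. \<forall>i<j. fst s i = p i"
    and nb: "\<not> branches L p j"
  shows "\<exists>s\<in>L. \<exists>i<j. (\<forall>i<j. fst s i = p i) \<and> (\<forall>t\<in>L. fst t j = fst s j \<longleftrightarrow> fst t i = p i)"
proof -
  obtain s where s: "s \<in> L" "\<forall>i<j. fst s i = p i" using full[OF p] by blast
  have nbs: "\<not> branches L (fst s) j" using nb branches_cong[of j "fst s" p L] s by simp
  have sT: "fst s \<in> tuples q k" "snd s \<in> tuples q k" using s L by auto
  \<comment> \<open>At a non-branching coordinate the codeword stores the label. Replacing it by its
    successor modulo \<open>q\<close> gives \<open>s'\<close> with the same colours as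
    \<open>s\<close>, the same labels beyond \<open>j\<close>, and a label at \<open>j\<close>
    larger by one modulo \<open>q\<close>.\<close>
  define a where "a = (snd s j + 1) mod q"
  have "(encode k L s)(j := a) \<in> tuples q k"
    by (rule tuples_upd[OF encode_in_tuples]) (use s L j q in \<open>auto simp: a_def\<close>)
  then obtain s' where s': "s' \<in> L" "encode k L s' = (encode k L s)(j := a)"
    using encode_surj[OF sep L card] by (metis imageE)
  have s'T: "fst s' \<in> tuples q k" "snd s' \<in> tuples q k" using s' L by auto
  have "fst s i = fst s' i" if "i < k" for i
    by (rule encode_prefix[OF s(1) s'(1) order_refl _ that]) (use nbs s' in auto)
  hence eq: "fst s = fst s'" using sT s'T by (intro tuples_eqI)
  have suf: "snd s i = snd s' i" if "j < i" "i < k" for i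
    by (rule encode_suffix[OF sep L s(1) s'(1) eq, of "Suc j"]) (use s' that in auto)
  have "encode k L s' j = a" using s' by simp
  hence s'j: "snd s' j = a" using nbs eq j by (simp add: encode_def)
  define d where "d i = int (snd s' i) - int (snd s i)" for i
  have dj: "[d j = 1] (mod int q)"
    unfolding d_def s'j a_def by (simp add: cong_def zmod_int mod_diff_left_eq)
  define below where "below t = {i. i < j \<and> fst s i = fst t i}" for t :: vtype
  \<comment> \<open>The difference \<open>d\<close> sums to zero over every agreement set and
    vanishes beyond \<open>j\<close>, while \<open>d j\<close> is one. So the sum over the earlier
    agreeing coordinates records whether \<open>t\<close> agrees with \<open>s\<close> at
    \<open>j\<close>.\<close>
  have orth: "[(\<Sum>i\<in>below t. d i) = (if fst t j = fst s j then -1 else 0)] (mod int q)" if t: "t \<in> L" for t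
  proof -
    define A where "A = agree k (fst s) (fst t)"
    define S where "S = (\<Sum>i\<in>below t. d i)"
    have "[(\<Sum>i\<in>A. snd s' i) = (\<Sum>i\<in>A. snd s i)] (mod q)"
      using sep s(1) s'(1) t eq unfolding separated_def A_def by (metis cong_sym)
    hence "[int (\<Sum>i\<in>A. snd s' i) = int (\<Sum>i\<in>A. snd s i)] (mod int q)" by (simp only: cong_int_iff)
    hence "[(\<Sum>i\<in>A. d i) = 0] (mod int q)"
      by (simp add: d_def sum_subtractf cong_iff_dvd_diff)
    moreover have "(\<Sum>i\<in>A. d i) = (\<Sum>i\<in>below t \<union> (if fst t j = fst s j then {j} else {}). d i)"
    proof (rule sum.mono_neutral_right)
      show "\<forall>i\<in>A - (below t \<union> (if fst t j = fst s j then {j} else {})). d i = 0"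
      proof
        fix i assume i: "i \<in> A - (below t \<union> (if fst t j = fst s j then {j} else {}))"
        hence "i < k" "\<not> i < j" "i \<noteq> j"
          by (auto simp: A_def agree_def below_def split: if_splits)
        thus "d i = 0" using suf[of i] by (simp add: d_def)
      qed
    qed (use j in \<open>auto simp: A_def agree_def below_def\<close>)
    moreover have "\<dots> = S + (if fst t j = fst s j then d j else 0)"
      unfolding S_def by (subst sum.union_disjoint) (auto simp: below_def)
    ultimately have 1: "[S + (if fst t j = fst s j then d j else 0) = 0] (mod int q)" by simp
    show ?thesis
    proof (cases "fst t j = fst s j")
      case True
      have "[S + d j = -1 + 1] (mod int q)" using 1 True by simp
      hence "[S + d j - d j = -1 + 1 - 1] (mod int q)" using dj by (intro cong_diff)
      thus ?thesis using True S_def by simp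
    qed (use 1 S_def in simp)
  qed
  have subset_sum: "[(\<Sum>i\<in>A. d i) = 0] (mod int q) \<or> [(\<Sum>i\<in>A. d i) = -1] (mod int q)" if A: "A \<subseteq> {..<j}" for A
  proof -
    \<comment> \<open>The vector \<open>r\<close> agrees with \<open>p\<close> on \<open>A\<close>
      and is shifted by one elsewhere; \<open>full\<close> realises its first \<open>j\<close>
      coordinates in \<open>L\<close>, so \<open>A\<close> is the set of earlier agreements of some
      \<open>t\<close>.\<close>
    define r where "r = (\<lambda>i\<in>{..<k}. if i \<in> A then p i else (p i + 1) mod q)"
    have "r \<in> tuples q k"
      unfolding r_def tuples_def using q tuples_lt[OF p] by (intro PiE_I) auto
    then obtain t where t: "t \<in> L" "\<forall>i<j. fst t i = r i" using full by blast
    have "(p i + 1) mod q \<noteq> p i" if "i < k" for i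
      using tuples_lt[OF p that] q by (cases "p i + 1 = q") auto
    hence "r i = p i \<longleftrightarrow> i \<in> A" if "i < j" for i
      using that j by (simp add: r_def)
    hence "i < j \<Longrightarrow> fst s i = fst t i \<longleftrightarrow> i \<in> A" for i
      using t(2) s(2) by metis
    hence "below t = A" using A by (auto simp: below_def)
    thus ?thesis using orth[OF t(1)] by (auto split: if_splits)
  qed
  \<comment> \<open>This is where \<open>q \<ge> 3\<close> enters: the residues 0, -1 and -2 are
    distinct.\<close>
  have n1: "\<not> [1 = 0] (mod int q)" "\<not> [-1 = 0] (mod int q)" "\<not> [-2 = 0] (mod int q)" "\<not> [-2 = -1] (mod int q)"
    using q zdvd_imp_le[of "int q" 2] zdvd_imp_le[of "int q" 1] by (auto simp: cong_iff_dvd_diff)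
  have "below s = {..<j}" by (auto simp: below_def)
  hence tot: "[(\<Sum>i<j. d i) = -1] (mod int q)" using orth[OF s(1)] by simp
  have "\<exists>i<j. \<not> [d i = 0] (mod int q)"
  proof (rule ccontr)
    assume "\<not> ?thesis"
    hence "\<forall>i<j. int q dvd d i" by (auto simp: cong_0_iff)
    hence "[(\<Sum>i<j. d i) = 0] (mod int q)" unfolding cong_0_iff by (intro dvd_sum) auto
    thus False using tot n1 cong_sym cong_trans by blast
  qed
  then obtain i where i: "i < j" "\<not> [d i = 0] (mod int q)" by blast
  have di: "[d i = -1] (mod int q)" using subset_sum[of "{i}"] i by simp
  \<comment> \<open>Two coordinates with value -1 would have the forbidden subset sum -2. Since the
    total is -1, exactly one coordinate below \<open>j\<close> carries it.\<close>
  have d0: "[d i' = 0] (mod int q)" if i': "i' < j" "i' \<noteq> i" for i'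
  proof (rule ccontr)
    assume c: "\<not> [d i' = 0] (mod int q)"
    have "[d i' = -1] (mod int q)" using subset_sum[of "{i'}"] i' c by simp
    with di have "[d i + d i' = -1 + -1] (mod int q)" by (rule cong_add)
    hence *: "[-2 = d i + d i'] (mod int q)" by (simp add: cong_sym)
    have "[d i + d i' = 0] (mod int q) \<or> [d i + d i' = -1] (mod int q)"
      using subset_sum[of "{i, i'}"] i i' by simp
    thus False using n1 cong_trans[OF *] by blast
  qed
  have iff: "fst t j = fst s j \<longleftrightarrow> fst t i = p i" if t: "t \<in> L" for t
  proof -
    have fb: "finite (below t)" by (simp add: below_def)
    have z: "[(\<Sum>i'\<in>below t - {i}. d i') = 0] (mod int q)"
      unfolding cong_0_iff by (intro dvd_sum) (use d0 in \<open>auto simp: below_def cong_0_iff\<close>)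
    have e: "[(\<Sum>i'\<in>below t. d i') = (if i \<in> below t then -1 else 0)] (mod int q)"
    proof (cases "i \<in> below t")
      case True
      have "(\<Sum>i'\<in>below t. d i') = d i + (\<Sum>i'\<in>below t - {i}. d i')"
        by (rule sum.remove[OF fb True])
      moreover have "[d i + (\<Sum>i'\<in>below t - {i}. d i') = -1 + 0] (mod int q)"
        by (rule cong_add[OF di z])
      ultimately show ?thesis using True by simp
    qed (use z in simp)
    have "[(if i \<in> below t then -1 else 0) = (if fst t j = fst s j then -1 else (0::int))] (mod int q)"
      by (rule cong_trans[OF cong_sym[OF e] orth[OF t]])
    hence "i \<in> below t \<longleftrightarrow> fst t j = fst s j"
      using n1(2) cong_sym[of 0 "-1" "int q"] by (auto split: if_splits)
    thus ?thesis using i s by (auto simp: below_def)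
  qed
  show ?thesis using s i iff by blast
qed

text \<open>By induction on \<open>j\<close>, every path of length \<open>j\<close> occurs in
  \<open>L\<close>. If all nodes at depth \<open>j\<close> branch, each continues with every colour
  by \<open>branch_attains\<close>. If one does not, one of its colours is governed by an earlier
  coordinate \<open>i0\<close>; then no node at depth \<open>j\<close> branches, all are governed by
  the same \<open>i0\<close>, and the coordinates \<open>i0\<close> and \<open>j\<close> induce the
  same partition, contrary to \<open>resolving\<close>.\<close>

lemma resolving_full_projection:
  assumes q: "q \<ge> 3" and sep: "separated q k L" and L: "L \<subseteq> tuples q k \<times> tuples q k"
    and card: "card L = q ^ k" and res: "resolving k L"
  shows "j \<le> k \<Longrightarrow> \<forall>p\<in>tuples q k. \<exists>s\<in>L. \<forall>i<j. fst s i = p i"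
proof (induction j)
  case 0
  have "L \<noteq> {}" using card q by auto
  thus ?case by auto
next
  case (Suc j)
  hence j: "j < k" and full: "\<And>p. p \<in> tuples q k \<Longrightarrow> \<exists>s\<in>L. \<forall>i<j. fst s i = p i" by auto
  have key: "\<exists>s\<in>L. \<exists>i<j. (\<forall>i<j. fst s i = p i) \<and> (\<forall>t\<in>L. fst t j = fst s j \<longleftrightarrow> fst t i = p i)"
    if "p \<in> tuples q k" "\<not> branches L p j" for p
    by (rule nonbranching_coordinate[OF q sep L card j that(1) full that(2)])
  have "branches L p j" if p: "p \<in> tuples q k" for p
  proof (rule ccontr)
    assume nb: "\<not> branches L p j"
    then obtain s0 i0 where s0: "s0 \<in> L" "i0 < j" "\<And>t. t \<in> L \<Longrightarrow> fst t j = fst s0 j \<longleftrightarrow> fst t i0 = p i0"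
      using key[OF p] by blast
    have s0j: "fst s0 j < q" using s0(1) L tuples_lt[of "fst s0" q k j] j by auto
    \<comment> \<open>If \<open>r\<close> has the colour of \<open>p\<close> at \<open>i0\<close>,
      the colour at \<open>j\<close> is forced. Otherwise a branching at \<open>r\<close> would
      attain the colour \<open>fst s0 j\<close>, which occurs only together with the colour of
      \<open>p\<close> at \<open>i0\<close>.\<close>
    have nball: "\<not> branches L r j" if r: "r \<in> tuples q k" for r
    proof
      assume b: "branches L r j"
      show False
      proof (cases "r i0 = p i0")
        case True
        from b obtain s t where st: "s \<in> L" "t \<in> L" "\<forall>i<j. fst s i = r i" "\<forall>i<j. fst t i = r i" "fst s j \<noteq> fst t j"
          unfolding branches_def by blast
        have "fst s i0 = p i0" "fst t i0 = p i0" using st s0(2) True by auto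
        thus False using s0(3)[OF st(1)] s0(3)[OF st(2)] st(5) by auto
      next
        case False
        obtain t where t: "t \<in> L" "\<forall>i<j. fst t i = r i" "fst t j = fst s0 j"
          using branch_attains[OF sep L card b j s0j] by blast
        thus False using s0(2) s0(3)[OF t(1)] False by auto
      qed
    qed
    have key': "\<exists>s1\<in>L. \<forall>t\<in>L. fst t j = fst s1 j \<longleftrightarrow> fst t i0 = r i0"
      if r: "r \<in> tuples q k" "r i0 \<noteq> p i0" for r
    proof -
      obtain s1 i1 where s1: "s1 \<in> L" "i1 < j" "\<forall>i<j. fst s1 i = r i"
          "\<And>t. t \<in> L \<Longrightarrow> fst t j = fst s1 j \<longleftrightarrow> fst t i1 = r i1"
        using key[OF r(1) nball[OF r(1)]] by blast
      have "i1 = i0"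
      proof (rule ccontr)
        assume ne: "i1 \<noteq> i0"
        \<comment> \<open>An element having the colour of \<open>p\<close> at \<open>i0\<close> and
          that of \<open>r\<close> at \<open>i1\<close> would give \<open>s0\<close> and
          \<open>s1\<close> the same colour at \<open>j\<close>, although \<open>r\<close> differs
          from \<open>p\<close> at \<open>i0\<close>.\<close>
        have "p(i1 := r i1) \<in> tuples q k"
          using tuples_upd[OF p, of i1 "r i1"] tuples_lt[OF r(1), of i1] s1(2) j by auto
        then obtain t where t: "t \<in> L" "\<forall>i<j. fst t i = (p(i1 := r i1)) i" using full by blast
        have "fst t i0 = p i0" "fst t i1 = r i1" using t s0(2) s1(2) ne by auto
        hence "fst s1 j = fst s0 j" using s0(3)[OF t(1)] s1(4)[OF t(1)] by simp
        thus False using s0(3)[OF s1(1)] s1(3) s0(2) r(2) by auto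
      qed
      thus ?thesis using s1 by blast
    qed
    have "(fst s i0 = fst t i0) = (fst s j = fst t j)" if st: "s \<in> L" "t \<in> L" for s t
    proof (cases "fst s i0 = p i0")
      case True
      thus ?thesis using s0(3)[OF st(1)] s0(3)[OF st(2)] by metis
    next
      case False
      have "fst s \<in> tuples q k" using st L by auto
      from key'[OF this False] obtain s1 where "s1 \<in> L" and s1: "\<forall>t\<in>L. fst t j = fst s1 j \<longleftrightarrow> fst t i0 = fst s i0"
        by (rule bexE)
      show ?thesis using bspec[OF s1 st(1)] bspec[OF s1 st(2)] by metis
    qed
    moreover have "i0 < k" "i0 \<noteq> j" using s0(2) j by auto
    ultimately show False using res j unfolding resolving_def by blast
  qed
  hence "\<exists>s\<in>L. (\<forall>i<j. fst s i = p i) \<and> fst s j = p j" if "p \<in> tuples q k" for p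
    using that branch_attains[OF sep L card _ j tuples_lt[OF that j]] by blast
  thus ?case unfolding less_Suc_eq by blast
qed

lemma resolving_projection:
  assumes q: "q \<ge> 3" and sep: "separated q k L" and L: "L \<subseteq> tuples q k \<times> tuples q k"
    and card: "card L = q ^ k" and res: "resolving k L"
  shows "bij_betw fst L (tuples q k)"
proof -
  have "tuples q k \<subseteq> fst ` L"
  proof
    fix p assume p: "p \<in> tuples q k"
    then obtain s where s: "s \<in> L" "\<forall>i<k. fst s i = p i"
      using resolving_full_projection[OF assms order_refl] by blast
    hence "fst s = p" using L p by (intro tuples_eqI[of _ q k]) auto
    thus "p \<in> fst ` L" using s by blast
  qed
  hence im: "fst ` L = tuples q k" using L by auto
  have fin: "finite L" using L by (rule finite_subset) auto
  have "inj_on fst L" by (rule eq_card_imp_inj_on[OF fin]) (simp add: im card)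
  thus ?thesis using im by (simp add: bij_betw_def)
qed

section \<open>Classification and count of the resolving maximum cliques\<close>

definition resolving_cliques :: "nat \<Rightarrow> nat \<Rightarrow> vtype set set" where
  "resolving_cliques q k = {L. L \<subseteq> tuples q k \<times> tuples q k \<and> card L = q ^ k \<and>
     (\<forall>s\<in>L. \<forall>t\<in>L. q dvd phase k s t) \<and> resolving k L}"

definition labelled_clique :: "nat \<Rightarrow> nat \<Rightarrow> (nat \<times> nat \<Rightarrow> nat) \<Rightarrow> vtype set" where
  "labelled_clique q k f = (\<lambda>g. (g, \<lambda>j\<in>{..<k}. f (j, g j))) ` tuples q k"

lemma tuples_exist:
  assumes "\<And>j. j < k \<Longrightarrow> g j < q"
  obtains p where "p \<in> tuples q k" "\<And>j. j < k \<Longrightarrow> p j = g j"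
  using that[of "restrict g {..<k}"] assms by (auto simp: tuples_def)

text \<open>Wherever two colour vectors agree, the labels there are the same value of
  \<open>f\<close>, so each summand of the phase is twice that value. The zero vector and its change
  at one coordinate show that coordinates are told apart.\<close>

lemma labelled_clique_resolving:
  assumes q: "q \<ge> 2" and f: "f \<in> ({..<k} \<times> {..<q}) \<rightarrow>\<^sub>E {a. a < q \<and> q dvd 2 * a}"
  shows "labelled_clique q k f \<in> resolving_cliques q k"
proof -
  have fv: "f (j, a) < q" "q dvd 2 * f (j, a)" if "j < k" "a < q" for j a
    using that PiE_mem[OF f, of "(j, a)"] by auto
  have 1: "labelled_clique q k f \<subseteq> tuples q k \<times> tuples q k"
  proof -
    have "(\<lambda>j\<in>{..<k}. f (j, g j)) \<in> tuples q k" if "g \<in> tuples q k" for g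
      unfolding tuples_def using fv(1) tuples_lt[OF that] by (intro PiE_I) auto
    thus ?thesis by (auto simp: labelled_clique_def)
  qed
  have "inj_on (\<lambda>g. (g, \<lambda>j\<in>{..<k}. f (j, g j))) (tuples q k)" by (auto simp: inj_on_def)
  hence 2: "card (labelled_clique q k f) = q ^ k"
    unfolding labelled_clique_def by (simp add: card_image)
  have 3: "q dvd phase k s t" if st: "s \<in> labelled_clique q k f" "t \<in> labelled_clique q k f" for s t
  proof -
    obtain g h where g: "g \<in> tuples q k" "s = (g, \<lambda>j\<in>{..<k}. f (j, g j))"
      and h: "h \<in> tuples q k" "t = (h, \<lambda>j\<in>{..<k}. f (j, h j))"
      using st by (auto simp: labelled_clique_def)
    have "q dvd snd s j + snd t j" if "j \<in> agree k (fst s) (fst t)" for j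
    proof -
      have "j < k" "g j = h j" using that g h by (auto simp: agree_def)
      hence "snd s j + snd t j = 2 * f (j, g j)" using g h by simp
      thus ?thesis using fv(2)[OF \<open>j < k\<close> tuples_lt[OF g(1) \<open>j < k\<close>]] by simp
    qed
    thus ?thesis unfolding phase_def by (intro dvd_sum)
  qed
  have 4: "resolving k (labelled_clique q k f)"
    unfolding resolving_def
  proof (intro allI impI)
    fix i j assume ij: "i < k" "j < k" "i \<noteq> j"
    obtain g where g: "g \<in> tuples q k" "\<And>j. j < k \<Longrightarrow> g j = 0"
      using tuples_exist[of k "\<lambda>_. 0" q] q by auto
    have h: "g(i := 1) \<in> tuples q k" using g q ij by (intro tuples_upd) auto
    let ?v = "\<lambda>g. (g, \<lambda>j\<in>{..<k}. f (j, g j))"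
    have "?v g \<in> labelled_clique q k f" "?v (g(i := 1)) \<in> labelled_clique q k f"
      unfolding labelled_clique_def by (rule imageI[OF g(1)], rule imageI[OF h])
    moreover have "(fst (?v g) i = fst (?v (g(i := 1))) i) \<noteq> (fst (?v g) j = fst (?v (g(i := 1))) j)"
      using g(2)[OF ij(1)] ij(3) by simp
    ultimately show "\<exists>s\<in>labelled_clique q k f. \<exists>t\<in>labelled_clique q k f. (fst s i = fst t i) \<noteq> (fst s j = fst t j)"
      by blast
  qed
  show ?thesis using 1 2 3 4 by (auto simp: resolving_cliques_def)
qed

lemma inj_on_labelled_clique:
  assumes q: "q \<ge> 1"
  shows "inj_on (labelled_clique q k) (({..<k} \<times> {..<q}) \<rightarrow>\<^sub>E B)"
proof (rule inj_onI)
  fix f f' assume f: "f \<in> ({..<k} \<times> {..<q}) \<rightarrow>\<^sub>E B" "f' \<in> ({..<k} \<times> {..<q}) \<rightarrow>\<^sub>E B"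
    and eq: "labelled_clique q k f = labelled_clique q k f'"
  show "f = f'"
  proof (rule PiE_ext[OF f])
    fix x :: "nat \<times> nat" assume "x \<in> {..<k} \<times> {..<q}"
    then obtain j a where x: "x = (j, a)" "j < k" "a < q" by auto
    obtain g where g: "g \<in> tuples q k" "\<And>j. j < k \<Longrightarrow> g j = a"
      using tuples_exist[of k "\<lambda>_. a" q] x by auto
    have "(g, \<lambda>j\<in>{..<k}. f (j, g j)) \<in> labelled_clique q k f'"
      unfolding eq[symmetric] unfolding labelled_clique_def by (rule image_eqI[where x = g]) (use g(1) in simp_all)
    hence "(\<lambda>j\<in>{..<k}. f (j, g j)) = (\<lambda>j\<in>{..<k}. f' (j, g j))" by (auto simp: labelled_clique_def)
    from fun_cong[OF this, of j] show "f x = f' x" using x g by simp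
  qed
qed

text \<open>The clique is the graph of a map \<open>m\<close> on colour vectors. Since
  \<open>q \<ge> 3\<close>, for \<open>g\<close> and \<open>h\<close> with a common colour at
  \<open>j\<close> there is an \<open>r\<close> that agrees with each of them at \<open>j\<close>
  only. Compatibility with \<open>r\<close> then gives both labels at \<open>j\<close> the same
  residue, so the label depends on the colour at \<open>j\<close> alone, and compatibility of
  \<open>g\<close> with such an \<open>r\<close> says that its double is divisible by
  \<open>q\<close>.\<close>

lemma resolving_clique_labelled:
  assumes q: "q \<ge> 3" and L: "L \<in> resolving_cliques q k"
  shows "L \<in> labelled_clique q k ` (({..<k} \<times> {..<q}) \<rightarrow>\<^sub>E {a. a < q \<and> q dvd 2 * a})"
proof -
  have LT: "L \<subseteq> tuples q k \<times> tuples q k" and card: "card L = q ^ k" and res: "resolving k L"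
    and cl: "\<And>s t. s \<in> L \<Longrightarrow> t \<in> L \<Longrightarrow> q dvd phase k s t"
    using L by (auto simp: resolving_cliques_def)
  have bij: "bij_betw fst L (tuples q k)"
    by (rule resolving_projection[OF q clique_separated[OF cl] LT card res])
  define m where "m g = snd (inv_into L fst g)" for g
  have mL: "(g, m g) \<in> L" if "g \<in> tuples q k" for g
  proof -
    have "inv_into L fst g \<in> L" "fst (inv_into L fst g) = g"
      using that bij by (auto simp: bij_betw_def inv_into_into f_inv_into_f)
    thus ?thesis unfolding m_def by (metis prod.collapse)
  qed
  have Lm: "snd s = m (fst s)" if "s \<in> L" for s
    unfolding m_def using bij that by (simp add: bij_betw_def)
  have opp: "q dvd m g j + m h j"
    if "g \<in> tuples q k" "h \<in> tuples q k" "j < k" "g j = h j" "\<And>i. i < k \<Longrightarrow> i \<noteq> j \<Longrightarrow> g i \<noteq> h i" for g h j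
  proof -
    have "agree k g h = {j}" using that by (auto simp: agree_def)
    thus ?thesis using cl[OF mL mL, OF that(1,2)] by (simp add: phase_def)
  qed
  have third: "\<exists>c<q. c \<noteq> a \<and> c \<noteq> b" for a b :: nat
  proof -
    have "\<not> {0, 1, 2} \<subseteq> {a, b}" using card_mono[of "{a, b}" "{0, 1, 2::nat}"] card_insert_le_m1[of 2 "{b}" a] by auto
    then obtain c where "c \<in> {0, 1, 2}" "c \<notin> {a, b}" by blast
    thus ?thesis using q by (intro exI[of _ c]) auto
  qed
  have sep: "\<exists>r\<in>tuples q k. r j = g j \<and> (\<forall>i<k. i \<noteq> j \<longrightarrow> r i \<noteq> g i \<and> r i \<noteq> h i)"
    if "g \<in> tuples q k" "j < k" for g h j
  proof -
    have gj: "g j < q" by (rule tuples_lt[OF that])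
    define c where "c i = (SOME c. c < q \<and> c \<noteq> g i \<and> c \<noteq> h i)" for i
    have c: "c i < q \<and> c i \<noteq> g i \<and> c i \<noteq> h i" for i
      unfolding c_def by (rule someI_ex) (use third in auto)
    obtain r where r: "r \<in> tuples q k" "\<And>i. i < k \<Longrightarrow> r i = (if i = j then g j else c i)"
      by (rule tuples_exist[of k "\<lambda>i. if i = j then g j else c i" q]) (use c gj in auto)
    show ?thesis by (rule bexI[OF _ r(1)]) (use c r(2) that(2) in auto)
  qed
  have mlt: "m g j < q" if "g \<in> tuples q k" "j < k" for g j
    using mL[OF that(1)] LT that(2) by (auto intro!: tuples_lt[of "m g" q k j])
  have indep: "m g j = m h j" if gh: "g \<in> tuples q k" "h \<in> tuples q k" "j < k" "g j = h j" for g h j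
  proof -
    obtain r where r: "r \<in> tuples q k" "r j = g j" "\<forall>i<k. i \<noteq> j \<longrightarrow> r i \<noteq> g i \<and> r i \<noteq> h i"
      using sep[OF gh(1,3)] by blast
    have "q dvd m g j + m r j" "q dvd m h j + m r j"
      using r gh by (auto intro!: opp)
    hence "[m g j = m h j] (mod q)" by (rule cong_dvd_add_cancel)
    thus ?thesis using mlt gh by (simp add: cong_def)
  qed
  have two: "q dvd 2 * m g j" if g: "g \<in> tuples q k" "j < k" for g j
  proof -
    obtain r where r: "r \<in> tuples q k" "r j = g j" "\<forall>i<k. i \<noteq> j \<longrightarrow> r i \<noteq> g i"
      using sep[OF g, of g] by blast
    have "q dvd m g j + m r j" using r g by (auto intro!: opp)
    moreover have "m r j = m g j" using r g by (intro indep) auto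
    ultimately show ?thesis by (simp add: mult_2)
  qed
  define f where "f = (\<lambda>(j, a)\<in>{..<k} \<times> {..<q}. m (\<lambda>i\<in>{..<k}. a) j)"
  have const: "(\<lambda>i\<in>{..<k}. a) \<in> tuples q k" if "a < q" for a
    using that by (auto simp: tuples_def)
  have f: "f \<in> ({..<k} \<times> {..<q}) \<rightarrow>\<^sub>E {a. a < q \<and> q dvd 2 * a}"
    unfolding f_def using mlt two const by (intro PiE_I) auto
  have mf: "m g = (\<lambda>j\<in>{..<k}. f (j, g j))" if g: "g \<in> tuples q k" for g
  proof (rule tuples_eqI)
    show mg: "m g \<in> tuples q k" using mL[OF g] LT by auto
    have "m g j = f (j, g j)" if "j < k" for j
      using that tuples_lt[OF g that] indep[OF g const that, of "g j"] by (simp add: f_def)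
    thus "\<And>j. j < k \<Longrightarrow> m g j = (\<lambda>j\<in>{..<k}. f (j, g j)) j" by simp
    thus "(\<lambda>j\<in>{..<k}. f (j, g j)) \<in> tuples q k"
      using tuples_lt[OF mg] by (auto simp: tuples_def)
  qed
  have "L = labelled_clique q k f"
  proof
    show "L \<subseteq> labelled_clique q k f"
    proof
      fix s assume s: "s \<in> L"
      hence g: "fst s \<in> tuples q k" using LT by auto
      have "s = (fst s, \<lambda>j\<in>{..<k}. f (j, fst s j))"
        using Lm[OF s] mf[OF g] by (simp add: prod_eq_iff)
      thus "s \<in> labelled_clique q k f" unfolding labelled_clique_def by (rule image_eqI[OF _ g])
    qed
    show "labelled_clique q k f \<subseteq> L" using mL mf by (auto simp: labelled_clique_def)
  qed
  thus ?thesis using f by blast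
qed

lemma card_resolving_cliques:
  assumes "q \<ge> 3"
  shows "card (resolving_cliques q k) = card {a. a < q \<and> q dvd 2 * a} ^ (k * q)"
proof -
  let ?F = "({..<k} \<times> {..<q}) \<rightarrow>\<^sub>E {a. a < q \<and> q dvd 2 * a}"
  have "resolving_cliques q k = labelled_clique q k ` ?F"
    using resolving_clique_labelled[OF assms] labelled_clique_resolving[of q] assms by fastforce
  hence "card (resolving_cliques q k) = card ?F"
    using inj_on_labelled_clique[of q k] assms by (simp add: card_image)
  thus ?thesis by (simp add: card_funcsetE card_cartesian_product)
qed

lemma card_half_roots:
  fixes q :: nat
  assumes "q > 0"
  shows "card {a. a < q \<and> q dvd 2 * a} = (if even q then 2 else 1)"
proof (cases "even q")
  case True
  then obtain r where r: "q = 2 * r" by blast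
  have "{a. a < q \<and> q dvd 2 * a} = {0, r}"
  proof (intro equalityI subsetI)
    fix a assume "a \<in> {a. a < q \<and> q dvd 2 * a}"
    hence a: "a < 2 * r" "r dvd a" using r by auto
    then obtain c where "a = r * c" by blast
    thus "a \<in> {0, r}" using a by (cases c) auto
  qed (use r assms in auto)
  thus ?thesis using True r assms by simp
next
  case False
  hence "coprime q 2" by (simp add: coprime_commute)
  hence "{a. a < q \<and> q dvd 2 * a} = {0}"
    using assms by (auto simp: coprime_dvd_mult_right_iff dest: dvd_imp_le)
  thus ?thesis using False by simp
qed

section \<open>Sums of pair weights over type assignments\<close>

definition pair_weight :: "('t \<Rightarrow> 't \<Rightarrow> complex) \<Rightarrow> nat \<Rightarrow> (nat \<Rightarrow> 't) \<Rightarrow> complex" where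
  "pair_weight \<Phi> n \<tau> = (\<Prod>(u, v)\<in>{(u, v). u \<in> {1..n} \<and> v \<in> {1..n} \<and> u < v}. \<Phi> (\<tau> u) (\<tau> v))"

text \<open>The properties of the edge means on which the asymptotics rest. A clique must also
  satisfy \<open>\<Phi> s s = 1\<close> for its members, so \<open>clique_dominates\<close> is not a
  consequence of \<open>clique_le\<close>: an outside type compatible with all of \<open>L\<close>
  might be incompatible with itself.\<close>

locale edge_weight =
  fixes T :: "'t set" and \<Phi> :: "'t \<Rightarrow> 't \<Rightarrow> complex" and K :: nat
  assumes finite_T: "finite T"
    and \<Phi>_commute: "\<And>s t. \<Phi> s t = \<Phi> t s"
    and norm_\<Phi>_le: "\<And>s t. norm (\<Phi> s t) \<le> 1"
    and norm_\<Phi>_eq: "\<And>s t. norm (\<Phi> s t) = 1 \<Longrightarrow> \<Phi> s t = 1"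
    and K_pos: "K > 0"
    and clique_le: "\<And>L. L \<subseteq> T \<Longrightarrow> \<forall>s\<in>L. \<forall>t\<in>L. \<Phi> s t = 1 \<Longrightarrow> card L \<le> K"
    and clique_dominates: "\<And>L t. L \<subseteq> T \<Longrightarrow> \<forall>s\<in>L. \<forall>t\<in>L. \<Phi> s t = 1 \<Longrightarrow> card L = K \<Longrightarrow>
           t \<in> T - L \<Longrightarrow> \<exists>s\<in>L. \<Phi> t s \<noteq> 1"
begin

definition max_cliques :: "'t set set" where
  "max_cliques = {L. L \<subseteq> T \<and> (\<forall>s\<in>L. \<forall>t\<in>L. \<Phi> s t = 1) \<and> card L = K}"

lemma finite_max_cliques: "finite max_cliques"
  by (rule finite_subset[of _ "Pow T"]) (unfold max_cliques_def, blast, simp add: finite_T)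

text \<open>There are finitely many norms below one, and \<open>\<sigma>\<close> is the square root
  of their maximum; the value 1/2 is added to keep it positive. The square root fits the count of
  ordered pairs, in which each pair of vertices appears twice.\<close>

lemma contraction_exists:
  "\<exists>\<sigma>::real. 0 < \<sigma> \<and> \<sigma> < 1 \<and> (\<forall>s\<in>T. \<forall>t\<in>T. \<Phi> s t \<noteq> 1 \<longrightarrow> norm (\<Phi> s t) \<le> \<sigma>\<^sup>2)"
proof -
  define R where "R = insert (1/2) ((\<lambda>(s, t). norm (\<Phi> s t)) ` {(s, t). s \<in> T \<and> t \<in> T \<and> \<Phi> s t \<noteq> 1})"
  have fin: "finite R"
  proof -
    have "finite {(s, t). s \<in> T \<and> t \<in> T \<and> \<Phi> s t \<noteq> 1}"
      by (rule finite_subset[of _ "T \<times> T"]) (auto simp: finite_T)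
    thus ?thesis by (simp add: R_def)
  qed
  have lt: "r < 1" if "r \<in> R" for r
  proof -
    have "norm (\<Phi> s t) < 1" if "\<Phi> s t \<noteq> 1" for s t
      using norm_\<Phi>_le[of s t] norm_\<Phi>_eq[of s t] that by linarith
    thus ?thesis using that by (auto simp: R_def)
  qed
  have "Max R < 1" using lt fin by (simp add: R_def)
  moreover have half: "1/2 \<le> Max R" using fin by (intro Max_ge) (auto simp: R_def)
  moreover have "norm (\<Phi> s t) \<le> Max R" if "s \<in> T" "t \<in> T" "\<Phi> s t \<noteq> 1" for s t
    using fin that by (intro Max_ge) (auto simp: R_def)
  ultimately show ?thesis
    by (intro exI[of _ "sqrt (Max R)"]) auto
qed

text \<open>Squaring turns the product over \<open>u < v\<close> into one over ordered pairs, so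
  sets of incompatible pairs can later be collected without regard to orientation.\<close>

lemma norm_pair_weight_square:
  "(norm (pair_weight \<Phi> n \<tau>))\<^sup>2 =
     (\<Prod>(u, v)\<in>{(u, v). u \<in> {1..n} \<and> v \<in> {1..n} \<and> u \<noteq> v}. norm (\<Phi> (\<tau> u) (\<tau> v)))"
proof -
  let ?P = "{(u, v). u \<in> {1..n} \<and> v \<in> {1..n} \<and> u < v}"
  let ?P' = "{(u, v). u \<in> {1..n} \<and> v \<in> {1..n} \<and> v < u}"
  let ?f = "\<lambda>(u, v). norm (\<Phi> (\<tau> u) (\<tau> v))"
  have fin: "finite ?P" "finite ?P'"
    by (rule finite_subset[of _ "{1..n} \<times> {1..n}"]; auto)+
  have nw: "norm (pair_weight \<Phi> n \<tau>) = prod ?f ?P"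
    unfolding pair_weight_def by (simp add: prod_norm[symmetric] case_prod_unfold)
  have "prod ?f ?P' = prod ?f ?P"
    by (rule prod.reindex_bij_witness[of _ prod.swap prod.swap]) (auto simp: \<Phi>_commute)
  hence "(norm (pair_weight \<Phi> n \<tau>))\<^sup>2 = prod ?f ?P * prod ?f ?P'"
    using nw by (simp add: power2_eq_square)
  also have "\<dots> = prod ?f (?P \<union> ?P')" using fin by (intro prod.union_disjoint[symmetric]) auto
  also have "?P \<union> ?P' = {(u, v). u \<in> {1..n} \<and> v \<in> {1..n} \<and> u \<noteq> v}" by auto
  finally show ?thesis .
qed

lemma norm_pair_weight_le:
  assumes \<sigma>: "0 < \<sigma>" "\<And>s t. s \<in> T \<Longrightarrow> t \<in> T \<Longrightarrow> \<Phi> s t \<noteq> 1 \<Longrightarrow> norm (\<Phi> s t) \<le> \<sigma>\<^sup>2"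
    and \<tau>: "\<tau> \<in> {1..n} \<rightarrow> T"
    and Q: "Q \<subseteq> {(u, v). u \<in> {1..n} \<and> v \<in> {1..n} \<and> u \<noteq> v}"
    and inc: "\<And>u v. (u, v) \<in> Q \<Longrightarrow> \<Phi> (\<tau> u) (\<tau> v) \<noteq> 1"
  shows "norm (pair_weight \<Phi> n \<tau>) \<le> \<sigma> ^ card Q"
proof (rule power2_le_imp_le)
  let ?O = "{(u, v). u \<in> {1..n} \<and> v \<in> {1..n} \<and> u \<noteq> v}"
  let ?f = "\<lambda>(u, v). norm (\<Phi> (\<tau> u) (\<tau> v))"
  have fin: "finite ?O" by (rule finite_subset[of _ "{1..n} \<times> {1..n}"]) auto
  have "(norm (pair_weight \<Phi> n \<tau>))\<^sup>2 = prod ?f (?O - Q) * prod ?f Q"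
    unfolding norm_pair_weight_square by (rule prod.subset_diff[OF Q fin])
  also have "\<dots> \<le> 1 * (\<Prod>p\<in>Q. \<sigma>\<^sup>2)"
  proof (rule mult_mono)
    show "prod ?f (?O - Q) \<le> 1" by (rule prod_le_1) (auto simp: norm_\<Phi>_le)
    show "prod ?f Q \<le> (\<Prod>p\<in>Q. \<sigma>\<^sup>2)"
    proof (rule prod_mono, safe)
      fix u v assume uv: "(u, v) \<in> Q"
      hence "u \<in> {1..n}" "v \<in> {1..n}" using Q by blast+
      hence "\<tau> u \<in> T" "\<tau> v \<in> T" using \<tau> by blast+
      thus "norm (\<Phi> (\<tau> u) (\<tau> v)) \<le> \<sigma>\<^sup>2" using \<sigma>(2) inc[OF uv] by blast
    qed simp
  qed (auto intro!: prod_nonneg)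
  also have "\<dots> = (\<sigma> ^ card Q)\<^sup>2" by (simp add: power_mult[symmetric] mult.commute)
  finally show "(norm (pair_weight \<Phi> n \<tau>))\<^sup>2 \<le> (\<sigma> ^ card Q)\<^sup>2" .
qed (use \<sigma> in simp)

lemma norm_pair_weight_le_1: "norm (pair_weight \<Phi> n \<tau>) \<le> 1"
  unfolding pair_weight_def by (auto simp: prod_norm[symmetric] norm_\<Phi>_le intro!: prod_le_1)

text \<open>The types occurring at least \<open>h\<close> times either contain an incompatible pair, or form a clique of size
  less than \<open>K\<close>, or form a maximum clique that some vertex lies outside; each case is paid for by one of the
  three summands. The weight \<open>1 / y\<close> per vertex outside \<open>L\<close> is a Chernoff bound for having few of them.\<close>

lemma nonmaximal_weight_bound:
  assumes \<sigma>: "0 < \<sigma>" "\<sigma> < 1" "\<And>s t. s \<in> T \<Longrightarrow> t \<in> T \<Longrightarrow> \<Phi> s t \<noteq> 1 \<Longrightarrow> norm (\<Phi> s t) \<le> \<sigma>\<^sup>2"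
    and h: "h \<ge> 1" and y: "y \<ge> (1::real)"
    and \<tau>: "\<tau> \<in> {1..n} \<rightarrow> T" and nonmax: "\<tau> ` {1..n} \<notin> max_cliques"
  shows "norm (pair_weight \<Phi> n \<tau>) \<le> \<sigma> ^ (h * (h - 1))
     + (\<Sum>L | L \<subseteq> T \<and> card L < K. y ^ (card T * h) * (\<Prod>v\<in>{1..n}. if \<tau> v \<in> L then 1 else 1 / y))
     + (\<Sum>L | L \<subseteq> T \<and> card L = K. (\<Prod>v\<in>{1..n}. if \<tau> v \<in> L then 1 else \<sigma> ^ h) - (\<Prod>v\<in>{1..n}. if \<tau> v \<in> L then 1 else 0))"
    (is "_ \<le> ?A + (\<Sum>L | ?P L. ?B L) + (\<Sum>L | ?P' L. ?C L)")
proof -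
  have finP: "finite {L. L \<subseteq> T \<and> R L}" for R
    by (rule finite_subset[of _ "Pow T"]) (blast, simp add: finite_T)
  have A0: "?A \<ge> 0" using \<sigma> by simp
  have B0: "?B L \<ge> 0" for L using y by (intro mult_nonneg_nonneg prod_nonneg) auto
  have C0: "?C L \<ge> 0" for L using \<sigma> by (simp, intro prod_mono) auto
  have sB0: "(\<Sum>L | ?P L. ?B L) \<ge> 0" by (intro sum_nonneg B0)
  have sC0: "(\<Sum>L | ?P' L. ?C L) \<ge> 0" by (intro sum_nonneg C0)
  define fib where "fib t = {v \<in> {1..n}. \<tau> v = t}" for t
  have finfib [simp]: "finite (fib t)" for t by (simp add: fib_def)
  define L where "L = {t \<in> T. card (fib t) \<ge> h}"
  have LT: "L \<subseteq> T" by (auto simp: L_def)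
  have Lfib: "card (fib t) \<ge> h" if "t \<in> L" for t using that by (simp add: L_def)
  define D where "D = {v \<in> {1..n}. \<tau> v \<notin> L}"
  have finD: "finite D" by (simp add: D_def)
  have prodD: "(\<Prod>v\<in>{1..n}. if \<tau> v \<in> L then 1 else z) = z ^ card D" for z :: real
  proof -
    have "(\<Prod>v\<in>{1..n}. if \<tau> v \<in> L then 1 else z) = (\<Prod>v\<in>D. z)"
      by (rule prod.mono_neutral_cong_right) (auto simp: D_def)
    thus ?thesis by simp
  qed
  show ?thesis
  proof (cases "\<forall>s\<in>L. \<forall>t\<in>L. \<Phi> s t = 1")
    case False
    then obtain s t where st: "s \<in> L" "t \<in> L" "\<Phi> s t \<noteq> 1" by blast
    \<comment> \<open>All pairs between the two fibres are incompatible. The types \<open>s\<close>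
      and \<open>t\<close> may coincide, so \<open>u\<close> itself is removed, which accounts for
      the factor \<open>h - 1\<close>.\<close>
    define Q where "Q = (SIGMA u:fib s. fib t - {u})"
    have w: "norm (pair_weight \<Phi> n \<tau>) \<le> \<sigma> ^ card Q"
      by (rule norm_pair_weight_le[OF \<sigma>(1,3) \<tau>]) (use st in \<open>auto simp: Q_def fib_def\<close>)
    have "h * (h - 1) \<le> card (fib s) * (h - 1)" using Lfib[OF st(1)] by simp
    also have "\<dots> = (\<Sum>u\<in>fib s. h - 1)" by simp
    also have "\<dots> \<le> (\<Sum>u\<in>fib s. card (fib t - {u}))"
    proof (rule sum_mono)
      fix u show "h - 1 \<le> card (fib t - {u})"
        using Lfib[OF st(2)] by (cases "u \<in> fib t") (auto simp: card_Diff_singleton)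
    qed
    also have "\<dots> = card Q" by (simp add: Q_def)
    finally have "h * (h - 1) \<le> card Q" .
    hence "\<sigma> ^ card Q \<le> ?A" using \<sigma> by (intro power_decreasing) auto
    with w show ?thesis using sB0 sC0 by linarith
  next
    case True
    hence "card L \<le> K" by (rule clique_le[OF LT])
    then consider "card L < K" | "card L = K" by linarith
    thus ?thesis
    proof cases
      case 1
      \<comment> \<open>Vertices outside \<open>L\<close> carry rare types, so there are at most
        \<open>card T * h\<close> of them. The prefactor of the second sum outweighs their factors
        \<open>1 / y\<close>, and the summand for \<open>L\<close> is at least one.\<close>
      have "D \<subseteq> (\<Union>t\<in>T - L. fib t)" using \<tau> by (auto simp: D_def fib_def)
      hence "card D \<le> card (\<Union>t\<in>T - L. fib t)" using finite_T by (intro card_mono) auto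
      also have "\<dots> \<le> (\<Sum>t\<in>T - L. card (fib t))" using finite_T by (intro card_UN_le) auto
      also have "\<dots> \<le> (\<Sum>t\<in>T - L. h)" by (intro sum_mono) (auto simp: L_def)
      also have "\<dots> \<le> card T * h" using finite_T by (simp add: card_mono)
      finally have "y ^ card D \<le> y ^ (card T * h)" using y by (intro power_increasing)
      hence "1 \<le> ?B L" unfolding prodD using y by (simp add: power_divide field_simps)
      also have "\<dots> \<le> (\<Sum>L | ?P L. ?B L)"
        by (rule member_le_sum) (use LT 1 B0 finP in auto)
      finally show ?thesis using norm_pair_weight_le_1[of n \<tau>] A0 sC0 by linarith
    next
      case 2
      \<comment> \<open>For nonempty \<open>D\<close> the subtracted product in the third sum
        vanishes, leaving the power of \<open>\<sigma>\<close>; for empty \<open>D\<close> the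
        summand would be zero.\<close>
      have D: "D \<noteq> {}"
      proof
        assume "D = {}"
        hence "\<tau> ` {1..n} \<subseteq> L" by (auto simp: D_def)
        moreover have "L \<subseteq> \<tau> ` {1..n}"
        proof
          fix t assume "t \<in> L"
          hence "fib t \<noteq> {}" using Lfib[of t] h by auto
          thus "t \<in> \<tau> ` {1..n}" by (auto simp: fib_def)
        qed
        ultimately have "\<tau> ` {1..n} = L" by blast
        thus False using nonmax True 2 LT by (simp add: max_cliques_def)
      qed
      have "\<exists>s\<in>L. \<Phi> (\<tau> v) s \<noteq> 1" if "v \<in> D" for v
        using that \<tau> by (intro clique_dominates[OF LT True 2]) (auto simp: D_def)
      then obtain g where g: "\<And>v. v \<in> D \<Longrightarrow> g v \<in> L" "\<And>v. v \<in> D \<Longrightarrow> \<Phi> (\<tau> v) (g v) \<noteq> 1" by metis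
      \<comment> \<open>Each vertex of \<open>D\<close> is paired with the whole fibre of a type
        incompatible with its own, that is with at least \<open>h\<close> vertices.\<close>
      define Q where "Q = (SIGMA v:D. fib (g v))"
      have Qsub: "Q \<subseteq> {(u, v). u \<in> {1..n} \<and> v \<in> {1..n} \<and> u \<noteq> v}"
      proof clarify
        fix v u assume "(v, u) \<in> Q"
        hence *: "v \<in> D" "u \<in> fib (g v)" by (auto simp: Q_def)
        hence "\<tau> v \<notin> L" "\<tau> u \<in> L" using g(1)[of v] by (auto simp: D_def fib_def)
        thus "v \<in> {1..n} \<and> u \<in> {1..n} \<and> v \<noteq> u" using * by (auto simp: D_def fib_def)
      qed
      have Qinc: "\<Phi> (\<tau> v) (\<tau> u) \<noteq> 1" if "(v, u) \<in> Q" for v u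
        using that g(2)[of v] by (auto simp: Q_def fib_def)
      have w: "norm (pair_weight \<Phi> n \<tau>) \<le> \<sigma> ^ card Q"
        by (rule norm_pair_weight_le[OF \<sigma>(1,3) \<tau>]) (assumption | rule Qsub Qinc)+
      have "h * card D = (\<Sum>v\<in>D. h)" by simp
      also have "\<dots> \<le> (\<Sum>v\<in>D. card (fib (g v)))" using g Lfib by (intro sum_mono) auto
      also have "\<dots> = card Q" using finD by (simp add: Q_def)
      finally have "h * card D \<le> card Q" .
      hence "\<sigma> ^ card Q \<le> \<sigma> ^ (h * card D)" using \<sigma> by (intro power_decreasing) auto
      also have "\<dots> = ?C L" unfolding prodD using D finD by (simp add: power_mult card_gt_0_iff)
      also have "\<dots> \<le> (\<Sum>L | ?P' L. ?C L)"
        by (rule member_le_sum) (use LT 2 C0 finP in auto)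
      finally show ?thesis using w A0 sB0 by linarith
    qed
  qed
qed

lemma sum_prod_indicator:
  fixes z :: real
  assumes "L \<subseteq> T"
  shows "(\<Sum>\<tau>\<in>{1..n} \<rightarrow>\<^sub>E T. \<Prod>v\<in>{1..n}. if \<tau> v \<in> L then 1 else z) = (real (card L) + real (card T - card L) * z) ^ n"
proof -
  have "(\<Sum>\<tau>\<in>{1..n} \<rightarrow>\<^sub>E T. \<Prod>v\<in>{1..n}. if \<tau> v \<in> L then 1 else z)
      = (\<Prod>v\<in>{1..n}. \<Sum>t\<in>T. if t \<in> L then 1 else z)"
    using finite_T by (subst prod_sum_PiE) auto
  also have "(\<Sum>t\<in>T. if t \<in> L then 1 else z) = real (card L) + real (card T - card L) * z"
    using finite_T assms
    by (simp add: sum.If_cases Int_absorb1 Diff_eq[symmetric] card_Diff_subset finite_subset)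
  finally show ?thesis by simp
qed

text \<open>The summands of the pointwise bound factor over the vertices. The choice
  \<open>y = 2 * M\<close> makes all types outside \<open>L\<close> together weigh at most 1/2, so a
  clique of fewer than \<open>K\<close> types has base at most \<open>K - 1 / 2\<close>. There are
  at most \<open>2 ^ card T\<close> sets \<open>L\<close>.\<close>

lemma nonmaximal_sum_bound:
  assumes \<sigma>: "0 < \<sigma>" "\<sigma> < 1" "\<And>s t. s \<in> T \<Longrightarrow> t \<in> T \<Longrightarrow> \<Phi> s t \<noteq> 1 \<Longrightarrow> norm (\<Phi> s t) \<le> \<sigma>\<^sup>2"
    and h: "h \<ge> 1" and y: "y \<ge> (1::real)" and M: "real (card T) \<le> M" and yM: "y = 2 * M"
  shows "(\<Sum>\<tau> | \<tau> \<in> {1..n} \<rightarrow>\<^sub>E T \<and> \<tau> ` {1..n} \<notin> max_cliques. norm (pair_weight \<Phi> n \<tau>))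
    \<le> M ^ n * \<sigma> ^ (h * (h - 1)) + 2 ^ card T * (y ^ (card T * h) * (real K - 1 / 2) ^ n)
      + 2 ^ card T * ((real K + M * \<sigma> ^ h) ^ n - real K ^ n)"
proof -
  let ?F = "{1..n} \<rightarrow>\<^sub>E T"
  let ?B = "\<lambda>L \<tau>. y ^ (card T * h) * (\<Prod>v\<in>{1..n}. if \<tau> v \<in> L then 1 else 1 / y)"
  let ?C = "\<lambda>L \<tau>. (\<Prod>v\<in>{1..n}. if \<tau> v \<in> L then 1 else \<sigma> ^ h) - (\<Prod>v\<in>{1..n}. if \<tau> v \<in> L then 1 else 0)"
  have finF: "finite ?F" using finite_T by (simp add: finite_PiE)
  have fin: "finite {L. L \<subseteq> T \<and> R L}" for R
    by (rule finite_subset[of _ "Pow T"]) (blast, simp add: finite_T)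
  have cardP: "real (card {L. L \<subseteq> T \<and> R L}) \<le> 2 ^ card T" for R
  proof -
    have "card {L. L \<subseteq> T \<and> R L} \<le> card (Pow T)" using finite_T by (intro card_mono) auto
    hence "real (card {L. L \<subseteq> T \<and> R L}) \<le> real (2 ^ card T)" using finite_T by (simp add: card_Pow)
    thus ?thesis by simp
  qed
  have M0: "M > 0" using y yM by simp
  have B0: "?B L \<tau> \<ge> 0" for L \<tau> using y by (intro mult_nonneg_nonneg prod_nonneg) auto
  have C0: "?C L \<tau> \<ge> 0" for L \<tau> using \<sigma> by (simp, intro prod_mono) auto
  have "(\<Sum>\<tau> | \<tau> \<in> ?F \<and> \<tau> ` {1..n} \<notin> max_cliques. norm (pair_weight \<Phi> n \<tau>))
      \<le> (\<Sum>\<tau> | \<tau> \<in> ?F \<and> \<tau> ` {1..n} \<notin> max_cliques. \<sigma> ^ (h * (h - 1)) + (\<Sum>L | L \<subseteq> T \<and> card L < K. ?B L \<tau>) + (\<Sum>L | L \<subseteq> T \<and> card L = K. ?C L \<tau>))"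
    by (rule sum_mono, rule nonmaximal_weight_bound[OF \<sigma> h y]) auto
  also have "\<dots> \<le> (\<Sum>\<tau>\<in>?F. \<sigma> ^ (h * (h - 1)) + (\<Sum>L | L \<subseteq> T \<and> card L < K. ?B L \<tau>) + (\<Sum>L | L \<subseteq> T \<and> card L = K. ?C L \<tau>))"
    using finF \<sigma> by (intro sum_mono2 add_nonneg_nonneg sum_nonneg B0 C0) auto
  also have "\<dots> = (\<Sum>\<tau>\<in>?F. \<sigma> ^ (h * (h - 1))) + (\<Sum>L | L \<subseteq> T \<and> card L < K. \<Sum>\<tau>\<in>?F. ?B L \<tau>) + (\<Sum>L | L \<subseteq> T \<and> card L = K. \<Sum>\<tau>\<in>?F. ?C L \<tau>)"
    unfolding sum.distrib by (subst (1 2) sum.swap) simp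
  also have "\<dots> \<le> M ^ n * \<sigma> ^ (h * (h - 1)) + 2 ^ card T * (y ^ (card T * h) * (real K - 1 / 2) ^ n)
      + 2 ^ card T * ((real K + M * \<sigma> ^ h) ^ n - real K ^ n)"
  proof (intro add_mono)
    have "(\<Sum>\<tau>\<in>?F. \<sigma> ^ (h * (h - 1))) = real (card T) ^ n * \<sigma> ^ (h * (h - 1))"
      by (simp add: card_funcsetE)
    also have "\<dots> \<le> M ^ n * \<sigma> ^ (h * (h - 1))"
      using M \<sigma> by (intro mult_right_mono power_mono) auto
    finally show "(\<Sum>\<tau>\<in>?F. \<sigma> ^ (h * (h - 1))) \<le> M ^ n * \<sigma> ^ (h * (h - 1))" .
  next
    have "(\<Sum>\<tau>\<in>?F. ?B L \<tau>) \<le> y ^ (card T * h) * (real K - 1 / 2) ^ n" if L: "L \<subseteq> T" "card L < K" for L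
    proof -
      have "(\<Sum>\<tau>\<in>?F. ?B L \<tau>) = y ^ (card T * h) * (real (card L) + real (card T - card L) * (1 / y)) ^ n"
        unfolding sum_distrib_left[symmetric] sum_prod_indicator[OF L(1)] ..
      also have "\<dots> \<le> y ^ (card T * h) * (real K - 1 / 2) ^ n"
      proof (intro mult_left_mono power_mono)
        have "real (card T - card L) * (1 / y) \<le> M * (1 / y)" using M y by (intro mult_right_mono) auto
        also have "\<dots> = 1 / 2" using M0 yM by simp
        finally show "real (card L) + real (card T - card L) * (1 / y) \<le> real K - 1 / 2"
          using L(2) by linarith
      qed (use y in auto)
      finally show ?thesis .
    qed
    hence "(\<Sum>L | L \<subseteq> T \<and> card L < K. \<Sum>\<tau>\<in>?F. ?B L \<tau>) \<le> (\<Sum>L | L \<subseteq> T \<and> card L < K. y ^ (card T * h) * (real K - 1 / 2) ^ n)"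
      by (intro sum_mono) auto
    also have "\<dots> \<le> 2 ^ card T * (y ^ (card T * h) * (real K - 1 / 2) ^ n)"
      unfolding sum_constant using cardP y K_pos by (intro mult_right_mono mult_nonneg_nonneg zero_le_power) auto
    finally show "(\<Sum>L | L \<subseteq> T \<and> card L < K. \<Sum>\<tau>\<in>?F. ?B L \<tau>) \<le> 2 ^ card T * (y ^ (card T * h) * (real K - 1 / 2) ^ n)" .
  next
    have "(\<Sum>\<tau>\<in>?F. ?C L \<tau>) \<le> (real K + M * \<sigma> ^ h) ^ n - real K ^ n" if L: "L \<subseteq> T" "card L = K" for L
    proof -
      have "(\<Sum>\<tau>\<in>?F. ?C L \<tau>) = (real K + real (card T - K) * \<sigma> ^ h) ^ n - real K ^ n"
        unfolding sum_subtractf sum_prod_indicator[OF L(1)] using L by simp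
      also have "\<dots> \<le> (real K + M * \<sigma> ^ h) ^ n - real K ^ n"
        using M \<sigma> by (intro diff_right_mono power_mono add_left_mono mult_right_mono) auto
      finally show ?thesis .
    qed
    hence "(\<Sum>L | L \<subseteq> T \<and> card L = K. \<Sum>\<tau>\<in>?F. ?C L \<tau>) \<le> (\<Sum>L | L \<subseteq> T \<and> card L = K. (real K + M * \<sigma> ^ h) ^ n - real K ^ n)"
      by (intro sum_mono) auto
    also have "\<dots> \<le> 2 ^ card T * ((real K + M * \<sigma> ^ h) ^ n - real K ^ n)"
      unfolding sum_constant using cardP M0 \<sigma> by (intro mult_right_mono) (auto intro!: power_mono)
    finally show "(\<Sum>L | L \<subseteq> T \<and> card L = K. \<Sum>\<tau>\<in>?F. ?C L \<tau>) \<le> 2 ^ card T * ((real K + M * \<sigma> ^ h) ^ n - real K ^ n)" .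
  qed
  finally show ?thesis .
qed

end

section \<open>Growth estimates for the three error terms\<close>

text \<open>The exponent lies strictly between 1/2 and 1: the square of the threshold must outgrow
  \<open>n\<close> to beat the exponential number of assignments, while the threshold itself must be
  sublinear so that \<open>y ^ (m * threshold n)\<close> does not cancel an exponential
  gain.\<close>

definition threshold :: "nat \<Rightarrow> nat" where
  "threshold n = nat \<lceil>real n powr (3 / 4)\<rceil>"

lemma threshold_bounds:
  shows "real n powr (3 / 4) \<le> real (threshold n)" "real (threshold n) \<le> real n powr (3 / 4) + 1"
    "n \<ge> 1 \<Longrightarrow> threshold n \<ge> 1"
proof -
  show 1: "real n powr (3 / 4) \<le> real (threshold n)"
    unfolding threshold_def by (rule real_nat_ceiling_ge)
  show "real (threshold n) \<le> real n powr (3 / 4) + 1"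
    using ceiling_correct[of "real n powr (3 / 4)"] by (simp add: threshold_def)
  show "threshold n \<ge> 1" if "n \<ge> 1"
  proof -
    have "real n powr (3 / 4) > 0" using that by simp
    thus ?thesis using 1 by linarith
  qed
qed

lemma power_eq_exp: "0 < (x::real) \<Longrightarrow> x ^ m = exp (real m * ln x)"
  by (simp add: exp_of_nat_mult)

lemma quadratic_decay:
  fixes M K \<sigma> :: real
  assumes "M > 0" "K > 0" "0 < \<sigma>" "\<sigma> < 1"
  shows "(\<lambda>n. M ^ n * \<sigma> ^ (threshold n * (threshold n - 1)) / K ^ n) \<longlonglongrightarrow> 0"
proof (rule Lim_null_comparison)
  define a where "a = ln (M / K)"
  define b where "b = - ln \<sigma>"
  have b: "b > 0" using assms by (simp add: b_def)
  show "(\<lambda>n. exp (real n * a - real n powr (3/4) * (real n powr (3/4) - 1) * b)) \<longlonglongrightarrow> 0"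
    using b by real_asymp
  show "\<forall>\<^sub>F n in sequentially. norm (M ^ n * \<sigma> ^ (threshold n * (threshold n - 1)) / K ^ n)
          \<le> exp (real n * a - real n powr (3/4) * (real n powr (3/4) - 1) * b)"
    using eventually_ge_at_top[of 1]
  proof eventually_elim
    case (elim n)
    let ?x = "real n powr (3/4)" and ?h = "threshold n"
    have h: "?x \<le> real ?h" "?h \<ge> 1" using threshold_bounds elim by auto
    have x: "?x \<ge> 1" using elim by (simp add: ge_one_powr_ge_zero)
    have "?x * (?x - 1) \<le> real ?h * (real ?h - 1)" using h x by (intro mult_mono) auto
    also have "\<dots> = real (?h * (?h - 1))" using h by (simp add: of_nat_diff)
    finally have le: "?x * (?x - 1) * b \<le> real (?h * (?h - 1)) * b" using b by (intro mult_right_mono) auto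
    have "M ^ n * \<sigma> ^ (?h * (?h - 1)) / K ^ n = (M / K) ^ n * \<sigma> ^ (?h * (?h - 1))"
      by (simp add: power_divide)
    also have "\<dots> = exp (real n * a) * exp (real (?h * (?h - 1)) * ln \<sigma>)"
      using assms unfolding a_def by (subst (1 2) power_eq_exp) auto
    also have "\<dots> = exp (real n * a - real (?h * (?h - 1)) * b)"
      by (simp add: exp_add[symmetric] b_def)
    also have "\<dots> \<le> exp (real n * a - ?x * (?x - 1) * b)" using le by simp
    finally show ?case using assms by simp
  qed
qed

lemma sublinear_growth_times_decay:
  fixes y K :: real and m :: nat
  assumes "y \<ge> 1" "K \<ge> 1"
  shows "(\<lambda>n. y ^ (m * threshold n) * (K - 1 / 2) ^ n / K ^ n) \<longlonglongrightarrow> 0"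
proof (rule Lim_null_comparison)
  define a where "a = real m * ln y"
  define b where "b = - ln ((K - 1 / 2) / K)"
  have b: "b > 0" using assms by (simp add: b_def)
  have a: "a \<ge> 0" using assms by (simp add: a_def)
  show "(\<lambda>n. exp ((real n powr (3/4) + 1) * a - real n * b)) \<longlonglongrightarrow> 0"
    using b by real_asymp
  show "\<forall>\<^sub>F n in sequentially. norm (y ^ (m * threshold n) * (K - 1 / 2) ^ n / K ^ n)
          \<le> exp ((real n powr (3/4) + 1) * a - real n * b)"
  proof (intro always_eventually allI)
    fix n
    have le: "real (threshold n) * a \<le> (real n powr (3/4) + 1) * a"
      using threshold_bounds(2)[of n] a by (intro mult_right_mono)
    have "y ^ (m * threshold n) * (K - 1 / 2) ^ n / K ^ n = y ^ (m * threshold n) * ((K - 1 / 2) / K) ^ n"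
      by (simp only: power_divide times_divide_eq_right)
    also have "\<dots> = exp (real (m * threshold n) * ln y) * exp (real n * - b)"
      using assms unfolding b_def by (subst (1 2) power_eq_exp) auto
    also have "\<dots> = exp (real (threshold n) * a - real n * b)"
      by (simp add: exp_add[symmetric] a_def mult_ac)
    also have "\<dots> \<le> exp ((real n powr (3/4) + 1) * a - real n * b)" using le by simp
    finally show "norm (y ^ (m * threshold n) * (K - 1 / 2) ^ n / K ^ n) \<le> exp ((real n powr (3/4) + 1) * a - real n * b)"
      using assms by (simp add: abs_mult)
  qed
qed

text \<open>The ratio is at most \<open>exp (n * C * \<sigma> ^ threshold n) - 1\<close> with
  \<open>C = M / K\<close>, and the exponent vanishes because the threshold grows like a power of
  \<open>n\<close>.\<close>

lemma perturbed_power_ratio: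
  fixes M K \<sigma> :: real
  assumes "M > 0" "K > 0" "0 < \<sigma>" "\<sigma> < 1"
  shows "(\<lambda>n. ((K + M * \<sigma> ^ threshold n) ^ n - K ^ n) / K ^ n) \<longlonglongrightarrow> 0"
proof (rule Lim_null_comparison)
  define b where "b = - ln \<sigma>"
  define C where "C = M / K"
  have b: "b > 0" using assms by (simp add: b_def)
  have C: "C > 0" using assms by (simp add: C_def)
  show "(\<lambda>n. exp (real n * C * exp (- (real n powr (3/4) * b))) - 1) \<longlonglongrightarrow> 0"
    using b C by real_asymp
  show "\<forall>\<^sub>F n in sequentially. norm (((K + M * \<sigma> ^ threshold n) ^ n - K ^ n) / K ^ n)
          \<le> exp (real n * C * exp (- (real n powr (3/4) * b))) - 1"
  proof (intro always_eventually allI)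
    fix n
    let ?s = "\<sigma> ^ threshold n"
    have s: "?s \<le> exp (- (real n powr (3/4) * b))"
      using assms threshold_bounds(1)[of n] by (subst power_eq_exp) (auto simp: b_def intro: mult_right_mono_neg)
    have "((K + M * ?s) ^ n - K ^ n) / K ^ n = (1 + C * ?s) ^ n - 1"
      using assms by (simp add: diff_divide_distrib C_def power_divide[symmetric] add_divide_distrib)
    moreover have "(1 + C * ?s) ^ n \<ge> 1" using C assms by (intro one_le_power) simp
    moreover have "(1 + C * ?s) ^ n \<le> exp (real n * C * exp (- (real n powr (3/4) * b)))"
    proof -
      have "(1 + C * ?s) ^ n \<le> exp (C * ?s) ^ n"
        using C assms exp_ge_add_one_self[of "C * ?s"] by (intro power_mono) auto
      also have "\<dots> = exp (real n * C * ?s)" by (simp add: exp_of_nat_mult[symmetric] mult_ac)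
      also have "\<dots> \<le> exp (real n * C * exp (- (real n powr (3/4) * b)))"
        using s C by (simp add: mult_left_mono)
      finally show ?thesis .
    qed
    ultimately show "norm (((K + M * ?s) ^ n - K ^ n) / K ^ n) \<le> exp (real n * C * exp (- (real n powr (3/4) * b))) - 1"
      by simp
  qed
qed

text \<open>A union bound over the missed value: at most \<open>K * (K - 1) ^ n\<close> maps are not
  onto.\<close>

lemma surjective_functions_ratio:
  assumes "card L = K" "K > 0"
  shows "(\<lambda>n. real (card {\<tau> \<in> {1..n} \<rightarrow>\<^sub>E L. \<tau> ` {1..n} = L}) / real K ^ n) \<longlonglongrightarrow> 1"
proof (rule tendsto_sandwich)
  have fL: "finite L" using assms card_ge_0_finite by blast
  have K: "real K > 0" using assms by simp
  show "(\<lambda>n. 1 - real K * ((real K - 1) / real K) ^ n) \<longlonglongrightarrow> 1"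
  proof -
    have "(\<lambda>n. ((real K - 1) / real K) ^ n) \<longlonglongrightarrow> 0"
      using assms by (intro LIMSEQ_realpow_zero) auto
    from tendsto_diff[OF tendsto_const tendsto_mult[OF tendsto_const this], of 1 "real K"] show ?thesis by simp
  qed
  let ?S = "\<lambda>n. {\<tau> \<in> {1..n} \<rightarrow>\<^sub>E L. \<tau> ` {1..n} = L}"
  have finF: "finite ({1..n} \<rightarrow>\<^sub>E L)" for n :: nat by (intro finite_PiE) (auto simp: fL)
  have total: "real (card ({1..n} \<rightarrow>\<^sub>E L)) = real K ^ n" for n :: nat
    using assms by (simp add: card_funcsetE)
  show "\<forall>\<^sub>F n in sequentially. real (card (?S n)) / real K ^ n \<le> 1"
  proof (intro always_eventually allI)
    fix n :: nat
    have "card (?S n) \<le> card ({1..n} \<rightarrow>\<^sub>E L)" by (intro card_mono finF) auto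
    hence "real (card (?S n)) \<le> real K ^ n" using total[of n] by linarith
    thus "real (card (?S n)) / real K ^ n \<le> 1" using K by simp
  qed
  show "\<forall>\<^sub>F n in sequentially. 1 - real K * ((real K - 1) / real K) ^ n \<le> real (card (?S n)) / real K ^ n"
  proof (intro always_eventually allI)
    fix n :: nat
    have "({1..n} \<rightarrow>\<^sub>E L) \<subseteq> ?S n \<union> (\<Union>t\<in>L. {1..n} \<rightarrow>\<^sub>E (L - {t}))" by (auto simp: PiE_iff)
    hence "card ({1..n} \<rightarrow>\<^sub>E L) \<le> card (?S n \<union> (\<Union>t\<in>L. {1..n} \<rightarrow>\<^sub>E (L - {t})))"
      using fL finF[of n] by (intro card_mono finite_UnI finite_UN_I finite_PiE) auto
    also have "\<dots> \<le> card (?S n) + card (\<Union>t\<in>L. {1..n} \<rightarrow>\<^sub>E (L - {t}))" by (rule card_Un_le)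
    also have "card (\<Union>t\<in>L. {1..n} \<rightarrow>\<^sub>E (L - {t})) \<le> (\<Sum>t\<in>L. card ({1..n} \<rightarrow>\<^sub>E (L - {t})))"
      by (rule card_UN_le[OF fL])
    also have "\<dots> = K * (K - 1) ^ n" using assms by (simp add: card_funcsetE)
    finally have "real (card ({1..n} \<rightarrow>\<^sub>E L)) \<le> real (card (?S n) + K * (K - 1) ^ n)" by linarith
    hence "real K ^ n \<le> real (card (?S n)) + real K * (real K - 1) ^ n"
      using total[of n] assms by (simp add: of_nat_diff)
    hence "real K ^ n / real K ^ n \<le> (real (card (?S n)) + real K * (real K - 1) ^ n) / real K ^ n"
      using K by (intro divide_right_mono) auto
    thus "1 - real K * ((real K - 1) / real K) ^ n \<le> real (card (?S n)) / real K ^ n"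
      using K by (simp add: add_divide_distrib power_divide)
  qed
qed auto

section \<open>Asymptotics of the weighted count of assignments\<close>

context edge_weight
begin

lemma nonmaximal_negligible:
  "(\<lambda>n. (\<Sum>\<tau> | \<tau> \<in> {1..n} \<rightarrow>\<^sub>E T \<and> \<tau> ` {1..n} \<notin> max_cliques. norm (pair_weight \<Phi> n \<tau>)) / real K ^ n)
     \<longlonglongrightarrow> 0"
proof -
  obtain \<sigma> where \<sigma>: "0 < \<sigma>" "\<sigma> < 1" "\<And>s t. s \<in> T \<Longrightarrow> t \<in> T \<Longrightarrow> \<Phi> s t \<noteq> 1 \<Longrightarrow> norm (\<Phi> s t) \<le> \<sigma>\<^sup>2"
    using contraction_exists by blast
  \<comment> \<open>The added one ensures \<open>M > 0\<close> and \<open>y \<ge> 1\<close> even for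
    empty \<open>T\<close>.\<close>
  define M where "M = real (card T) + 1"
  define y where "y = 2 * M"
  have M: "M > 0" "real (card T) \<le> M" and y: "y \<ge> 1" by (auto simp: M_def y_def)
  have K: "real K \<ge> 1" using K_pos by simp
  define R where "R n = M ^ n * \<sigma> ^ (threshold n * (threshold n - 1)) / real K ^ n
     + 2 ^ card T * (y ^ (card T * threshold n) * (real K - 1 / 2) ^ n / real K ^ n)
     + 2 ^ card T * (((real K + M * \<sigma> ^ threshold n) ^ n - real K ^ n) / real K ^ n)" for n
  show ?thesis
  proof (rule Lim_null_comparison)
    have "R \<longlonglongrightarrow> 0 + 2 ^ card T * 0 + 2 ^ card T * 0"
      unfolding R_def using \<sigma> M y K
      by (intro tendsto_add tendsto_mult tendsto_const quadratic_decay sublinear_growth_times_decay perturbed_power_ratio) auto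
    thus "R \<longlonglongrightarrow> 0" by simp
    show "\<forall>\<^sub>F n in sequentially. norm ((\<Sum>\<tau> | \<tau> \<in> {1..n} \<rightarrow>\<^sub>E T \<and> \<tau> ` {1..n} \<notin> max_cliques. norm (pair_weight \<Phi> n \<tau>)) / real K ^ n) \<le> R n"
      using eventually_ge_at_top[of 1]
    proof eventually_elim
      case (elim n)
      have "(\<Sum>\<tau> | \<tau> \<in> {1..n} \<rightarrow>\<^sub>E T \<and> \<tau> ` {1..n} \<notin> max_cliques. norm (pair_weight \<Phi> n \<tau>)) / real K ^ n
        \<le> (M ^ n * \<sigma> ^ (threshold n * (threshold n - 1)) + 2 ^ card T * (y ^ (card T * threshold n) * (real K - 1 / 2) ^ n)
      + 2 ^ card T * ((real K + M * \<sigma> ^ threshold n) ^ n - real K ^ n)) / real K ^ n"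
        using K by (intro divide_right_mono nonmaximal_sum_bound[OF \<sigma> threshold_bounds(3)[OF elim] y M(2) y_def]) auto
      also have "\<dots> = R n" unfolding R_def by (simp only: add_divide_distrib times_divide_eq_right)
      finally show ?case by (simp add: sum_nonneg)
    qed
  qed
qed

text \<open>An assignment onto a maximum clique has weight one, so those onto members of
  \<open>G\<close> are merely counted, and each member contributes asymptotically
  \<open>K ^ n\<close>. All other assignments are negligible in absolute value, which is why
  \<open>good\<close> has to be described only on assignments onto maximum cliques.\<close>

theorem weighted_count_asymptotics:
  assumes G: "G \<subseteq> max_cliques"
    and good: "\<And>n \<tau>. \<tau> \<in> {1..n} \<rightarrow>\<^sub>E T \<Longrightarrow> \<tau> ` {1..n} \<in> max_cliques \<Longrightarrow> good n \<tau> \<longleftrightarrow> \<tau> ` {1..n} \<in> G"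
  shows "(\<lambda>n. (\<Sum>\<tau> | \<tau> \<in> {1..n} \<rightarrow>\<^sub>E T \<and> good n \<tau>. pair_weight \<Phi> n \<tau>) / of_nat K ^ n)
           \<longlonglongrightarrow> of_nat (card G)"
proof -
  define S where "S L n = {\<tau> \<in> {1..n} \<rightarrow>\<^sub>E L. \<tau> ` {1..n} = L}" for L :: "'t set" and n :: nat
  let ?F = "\<lambda>n::nat. {1..n} \<rightarrow>\<^sub>E T"
  have finF: "finite (?F n)" for n using finite_T by (simp add: finite_PiE)
  have finG: "finite G" using G finite_max_cliques finite_subset by blast
  have main: "(\<Sum>\<tau> | \<tau> \<in> ?F n \<and> good n \<tau> \<and> \<tau> ` {1..n} \<in> max_cliques. pair_weight \<Phi> n \<tau>)
      = of_nat (\<Sum>L\<in>G. card (S L n))" for n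
  proof -
    have "{\<tau>. \<tau> \<in> ?F n \<and> good n \<tau> \<and> \<tau> ` {1..n} \<in> max_cliques} = (\<Union>L\<in>G. S L n)"
    proof (intro equalityI subsetI)
      fix \<tau> assume "\<tau> \<in> {\<tau>. \<tau> \<in> ?F n \<and> good n \<tau> \<and> \<tau> ` {1..n} \<in> max_cliques}"
      hence "\<tau> \<in> ?F n" "\<tau> ` {1..n} \<in> G" using good by auto
      moreover from this have "\<tau> \<in> S (\<tau> ` {1..n}) n" unfolding S_def PiE_def by blast
      ultimately show "\<tau> \<in> (\<Union>L\<in>G. S L n)" by blast
    next
      fix \<tau> assume "\<tau> \<in> (\<Union>L\<in>G. S L n)"
      then obtain L where L: "L \<in> G" "\<tau> \<in> {1..n} \<rightarrow>\<^sub>E L" "\<tau> ` {1..n} = L" by (auto simp: S_def)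
      have "L \<subseteq> T" using L(1) G by (auto simp: max_cliques_def)
      hence "\<tau> \<in> ?F n" using L(2) PiE_mono[of "{1..n}" "\<lambda>_. L" "\<lambda>_. T"] by blast
      thus "\<tau> \<in> {\<tau>. \<tau> \<in> ?F n \<and> good n \<tau> \<and> \<tau> ` {1..n} \<in> max_cliques}" using L G good[of \<tau> n] by auto
    qed
    hence "(\<Sum>\<tau> | \<tau> \<in> ?F n \<and> good n \<tau> \<and> \<tau> ` {1..n} \<in> max_cliques. pair_weight \<Phi> n \<tau>)
        = (\<Sum>\<tau>\<in>(\<Union>L\<in>G. S L n). 1)"
    proof (rule sum.cong)
      fix \<tau> assume "\<tau> \<in> (\<Union>L\<in>G. S L n)"
      then obtain L where L: "L \<in> G" "\<tau> ` {1..n} = L" by (auto simp: S_def)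
      hence "\<Phi> (\<tau> u) (\<tau> v) = 1" if "u \<in> {1..n}" "v \<in> {1..n}" for u v
        using G that by (auto simp: max_cliques_def)
      thus "pair_weight \<Phi> n \<tau> = 1" unfolding pair_weight_def by (intro prod.neutral) auto
    qed
    also have "\<dots> = of_nat (card (\<Union>L\<in>G. S L n))" by simp
    also have "card (\<Union>L\<in>G. S L n) = (\<Sum>L\<in>G. card (S L n))"
    proof (rule card_UN_disjoint[OF finG])
      show "\<forall>L\<in>G. finite (S L n)"
      proof
        fix L assume "L \<in> G"
        hence "L \<subseteq> T" using G by (auto simp: max_cliques_def)
        hence "finite ({1..n} \<rightarrow>\<^sub>E L)" using finite_T by (simp add: finite_PiE finite_subset)
        thus "finite (S L n)" unfolding S_def by simp
      qed
      show "\<forall>L\<in>G. \<forall>L'\<in>G. L \<noteq> L' \<longrightarrow> S L n \<inter> S L' n = {}" unfolding S_def by blast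
    qed
    finally show ?thesis .
  qed
  have "(\<lambda>n. (\<Sum>L\<in>G. complex_of_real (real (card (S L n)) / real K ^ n))) \<longlonglongrightarrow> (\<Sum>L\<in>G. complex_of_real 1)"
    unfolding S_def using G K_pos
    by (intro tendsto_sum tendsto_of_real surjective_functions_ratio) (auto simp: max_cliques_def)
  moreover have "(\<Sum>L\<in>G. complex_of_real (real (card (S L n)) / real K ^ n))
      = (\<Sum>\<tau> | \<tau> \<in> ?F n \<and> good n \<tau> \<and> \<tau> ` {1..n} \<in> max_cliques. pair_weight \<Phi> n \<tau>) / of_nat K ^ n" for n
    unfolding main by (simp add: sum_divide_distrib)
  ultimately have lim1: "(\<lambda>n. (\<Sum>\<tau> | \<tau> \<in> ?F n \<and> good n \<tau> \<and> \<tau> ` {1..n} \<in> max_cliques. pair_weight \<Phi> n \<tau>) / of_nat K ^ n)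
      \<longlonglongrightarrow> of_nat (card G)" by simp
  have lim2: "(\<lambda>n. (\<Sum>\<tau> | \<tau> \<in> ?F n \<and> good n \<tau> \<and> \<tau> ` {1..n} \<notin> max_cliques. pair_weight \<Phi> n \<tau>) / of_nat K ^ n) \<longlonglongrightarrow> 0"
  proof (rule Lim_null_comparison[OF always_eventually nonmaximal_negligible], rule allI)
    fix n
    have "norm (\<Sum>\<tau> | \<tau> \<in> ?F n \<and> good n \<tau> \<and> \<tau> ` {1..n} \<notin> max_cliques. pair_weight \<Phi> n \<tau>)
        \<le> (\<Sum>\<tau> | \<tau> \<in> ?F n \<and> good n \<tau> \<and> \<tau> ` {1..n} \<notin> max_cliques. norm (pair_weight \<Phi> n \<tau>))"
      by (rule norm_sum)
    also have "\<dots> \<le> (\<Sum>\<tau> | \<tau> \<in> ?F n \<and> \<tau> ` {1..n} \<notin> max_cliques. norm (pair_weight \<Phi> n \<tau>))"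
      using finF by (intro sum_mono2) auto
    finally show "norm ((\<Sum>\<tau> | \<tau> \<in> ?F n \<and> good n \<tau> \<and> \<tau> ` {1..n} \<notin> max_cliques. pair_weight \<Phi> n \<tau>) / of_nat K ^ n)
        \<le> (\<Sum>\<tau> | \<tau> \<in> ?F n \<and> \<tau> ` {1..n} \<notin> max_cliques. norm (pair_weight \<Phi> n \<tau>)) / real K ^ n"
      by (simp add: norm_divide norm_power divide_right_mono)
  qed
  have "(\<Sum>\<tau> | \<tau> \<in> ?F n \<and> good n \<tau>. pair_weight \<Phi> n \<tau>) =
      (\<Sum>\<tau> | \<tau> \<in> ?F n \<and> good n \<tau> \<and> \<tau> ` {1..n} \<in> max_cliques. pair_weight \<Phi> n \<tau>)
      + (\<Sum>\<tau> | \<tau> \<in> ?F n \<and> good n \<tau> \<and> \<tau> ` {1..n} \<notin> max_cliques. pair_weight \<Phi> n \<tau>)" for n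
    using finF by (subst sum.union_disjoint[symmetric]) (auto intro!: sum.cong)
  thus ?thesis using tendsto_add[OF lim1 lim2] by (simp add: add_divide_distrib)
qed

end

section \<open>Partitions and colourings\<close>

text \<open>Indexing by vertices rather than by colours leaves out empty classes, as
  \<open>partition_on\<close> demands.\<close>

definition classes :: "'a set \<Rightarrow> ('a \<Rightarrow> 'b) \<Rightarrow> 'a set set" where
  "classes V c = (\<lambda>v. {u \<in> V. c u = c v}) ` V"

text \<open>Surjectivity corresponds to exactly \<open>q\<close> nonempty parts; extensionality
  makes each partition arise from finitely many colourings.\<close>

definition colourings :: "nat \<Rightarrow> 'a set \<Rightarrow> ('a \<Rightarrow> nat) set" where
  "colourings q V = {c \<in> V \<rightarrow>\<^sub>E {..<q}. c ` V = {..<q}}"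

definition mono_edge :: "('a \<Rightarrow> 'b) \<Rightarrow> 'a set \<Rightarrow> bool" where
  "mono_edge c e \<longleftrightarrow> (\<forall>u\<in>e. \<forall>v\<in>e. c u = c v)"

text \<open>The monochromatic edges at \<open>v\<close> are the edges at \<open>v\<close> inside its
  colour class, so this is the divisibility condition expressed vertex by vertex, without reference
  to the parts.\<close>

definition balanced :: "nat \<Rightarrow> 'a set \<Rightarrow> 'a set set \<Rightarrow> ('a \<Rightarrow> nat) \<Rightarrow> bool" where
  "balanced q V E c \<longleftrightarrow> (\<forall>v\<in>V. q dvd card {e \<in> E. v \<in> e \<and> mono_edge c e})"

lemma same_class_iff:
  "u \<in> V \<Longrightarrow> v \<in> V \<Longrightarrow> c u = c v \<longleftrightarrow> (\<exists>A\<in>classes V c. u \<in> A \<and> v \<in> A)"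
  by (auto simp: classes_def)

lemma classes_eq_iff:
  "classes V c = classes V c' \<longleftrightarrow> (\<forall>u\<in>V. \<forall>v\<in>V. (c u = c v) = (c' u = c' v))"
proof
  assume eq: "classes V c = classes V c'"
  show "\<forall>u\<in>V. \<forall>v\<in>V. (c u = c v) = (c' u = c' v)"
    using same_class_iff[of _ V _ c] same_class_iff[of _ V _ c'] unfolding eq by blast
next
  assume "\<forall>u\<in>V. \<forall>v\<in>V. (c u = c v) = (c' u = c' v)"
  thus "classes V c = classes V c'" unfolding classes_def by (intro image_cong refl) auto
qed

lemma partition_on_classes: "partition_on V (classes V c)"
  by (rule partition_onI) (auto simp: classes_def disjnt_def)

lemma card_classes:
  assumes "c \<in> colourings q V"
  shows "card (classes V c) = q"
proof -
  have im: "c ` V = {..<q}" using assms by (simp add: colourings_def)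
  have "classes V c = (\<lambda>a. {u \<in> V. c u = a}) ` {..<q}"
    unfolding classes_def im[symmetric] by (simp add: image_image)
  moreover have "inj_on (\<lambda>a. {u \<in> V. c u = a}) {..<q}"
  proof (rule inj_onI)
    fix a b assume "a \<in> {..<q}" and eq: "{u \<in> V. c u = a} = {u \<in> V. c u = b}"
    then obtain v where "v \<in> V" "c v = a" using im by (metis imageE)
    thus "a = b" using eq by blast
  qed
  ultimately show ?thesis by (simp add: card_image)
qed

lemma classes_in_divisible_partitions:
  assumes E: "E \<subseteq> [V]\<^bsup>2\<^esup>" and c: "c \<in> colourings q V"
  shows "classes V c \<in> divisible_partitions q V E \<longleftrightarrow> balanced q V E c"
proof -
  have deg: "vdegree (induced E {u \<in> V. c u = c w}) v = card {e \<in> E. v \<in> e \<and> mono_edge c e}"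
    if "v \<in> {u \<in> V. c u = c w}" for v w
  proof -
    have "{e \<in> induced E {u \<in> V. c u = c w}. v \<in> e} = {e \<in> E. v \<in> e \<and> mono_edge c e}"
    proof (intro equalityI subsetI)
      fix e assume "e \<in> {e \<in> induced E {u \<in> V. c u = c w}. v \<in> e}"
      hence "e \<in> E" "v \<in> e" and w: "\<forall>u\<in>e. c u = c w" by (auto simp: induced_def)
      moreover have "mono_edge c e" using w by (simp add: mono_edge_def)
      ultimately show "e \<in> {e \<in> E. v \<in> e \<and> mono_edge c e}" by simp
    next
      fix e assume e: "e \<in> {e \<in> E. v \<in> e \<and> mono_edge c e}"
      hence "e \<subseteq> V" using E by (auto simp: nsets_def)
      moreover have "\<forall>u\<in>e. c u = c w"
      proof
        fix u assume "u \<in> e"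
        hence "c u = c v" using e unfolding mono_edge_def by blast
        also have "c v = c w" using that by simp
        finally show "c u = c w" .
      qed
      ultimately have "e \<subseteq> {u \<in> V. c u = c w}" by blast
      thus "e \<in> {e \<in> induced E {u \<in> V. c u = c w}. v \<in> e}" using e by (simp add: induced_def)
    qed
    thus ?thesis by (simp add: vdegree_def)
  qed
  have "(\<forall>A\<in>classes V c. \<forall>v\<in>A. q dvd vdegree (induced E A) v) \<longleftrightarrow>
        (\<forall>w\<in>V. \<forall>v\<in>{u \<in> V. c u = c w}. q dvd card {e \<in> E. v \<in> e \<and> mono_edge c e})"
    unfolding classes_def by (simp add: deg)
  also have "\<dots> \<longleftrightarrow> balanced q V E c" unfolding balanced_def by blast
  finally show ?thesis
    using partition_on_classes[of V c] card_classes[OF c] by (simp add: divisible_partitions_def)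
qed

lemma card_injections_PiE:
  assumes "finite A" "finite B"
  shows "card {f \<in> A \<rightarrow>\<^sub>E B. inj_on f A} = fact (card A) * (card B choose card A)"
proof -
  have "card {f \<in> A \<rightarrow>\<^sub>E B. inj_on f A} = (\<Prod>i = 0..<card A. card B - i)"
    by (subst card_inj_on_subset_funcset[OF assms order_refl]) simp
  also have "real \<dots> = real (fact (card A) * (card B choose card A))"
  proof (cases "card A \<le> card B")
    case True
    have "real (\<Prod>i = 0..<card A. card B - i) = (\<Prod>i = 0..<card A. real (card B) - real i)"
      unfolding of_nat_prod using True by (intro prod.cong refl) (auto simp: of_nat_diff)
    also have "\<dots> = fact (card A) * (real (card B) gchoose card A)"
      by (simp add: gbinomial_prod_rev)
    finally show ?thesis by (simp add: binomial_gbinomial)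
  next
    case False
    hence "(\<Prod>i = 0..<card A. card B - i) = 0" by (intro prod_zero bexI[of _ "card B"]) auto
    thus ?thesis using False by (simp add: binomial_eq_0)
  qed
  finally show ?thesis by (simp only: of_nat_eq_iff)
qed

text \<open>Colourings with classes \<open>P\<close> correspond to bijections from \<open>P\<close>
  onto the colours: \<open>G\<close> colours each vertex through its part, and \<open>H\<close>
  reads off the colour of a part at a representative.\<close>

lemma card_colourings_with_classes:
  assumes P: "partition_on V P" "card P = q" and V: "finite V"
  shows "card {c \<in> colourings q V. classes V c = P} = fact q"
proof -
  have finP: "finite P" using finite_elements[OF V P(1)] .
  have UP: "\<Union>P = V" and ne: "\<And>A. A \<in> P \<Longrightarrow> A \<noteq> {}"
    using P(1) by (auto simp: partition_on_def)
  have uniq: "A = B" if "A \<in> P" "B \<in> P" "v \<in> A" "v \<in> B" for A B v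
    using P(1) that by (auto simp: partition_on_def disjoint_def)
  have "\<forall>v\<in>V. \<exists>A. A \<in> P \<and> v \<in> A" using UP by blast
  then obtain cls where cls: "\<And>v. v \<in> V \<Longrightarrow> cls v \<in> P" "\<And>v. v \<in> V \<Longrightarrow> v \<in> cls v" by metis
  have cls_eq: "cls v = A" if "v \<in> A" "A \<in> P" for v A
  proof -
    have "v \<in> V" using that UP by blast
    thus ?thesis using cls[of v] that uniq by blast
  qed
  obtain rep where rep: "\<And>A. A \<in> P \<Longrightarrow> rep A \<in> A" using ne by (metis all_not_in_conv)
  have repV: "rep A \<in> V" if "A \<in> P" for A using rep[OF that] that UP by blast
  have clsV: "cls ` V = P"
  proof (intro equalityI subsetI)
    fix A assume A: "A \<in> P"
    have "A = cls (rep A)" by (rule cls_eq[OF rep[OF A] A, symmetric])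
    thus "A \<in> cls ` V" using repV[OF A] by (rule image_eqI)
  qed (use cls(1) in auto)
  define G where "G f = (\<lambda>v\<in>V. f (cls v) :: nat)" for f
  define H where "H c = (\<lambda>A\<in>P. c (rep A) :: nat)" for c
  let ?I = "{f \<in> P \<rightarrow>\<^sub>E {..<q}. inj_on f P}"
  let ?C = "{c \<in> colourings q V. classes V c = P}"
  have "bij_betw G ?I ?C"
  proof (rule bij_betw_byWitness[where f' = H])
    show "\<forall>f\<in>?I. H (G f) = f"
    proof
      fix f assume "f \<in> ?I"
      hence f: "f \<in> P \<rightarrow>\<^sub>E {..<q}" by simp
      show "H (G f) = f"
      proof
        fix A show "H (G f) A = f A"
          using f rep[of A] repV[of A] cls_eq[of "rep A" A] by (cases "A \<in> P") (auto simp: H_def G_def)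
      qed
    qed
    show "\<forall>c\<in>?C. G (H c) = c"
    proof
      fix c assume c: "c \<in> ?C"
      hence ext: "c \<in> V \<rightarrow>\<^sub>E {..<q}" and cP: "classes V c = P" by (auto simp: colourings_def)
      show "G (H c) = c"
      proof
        fix v show "G (H c) v = c v"
        proof (cases "v \<in> V")
          case True
          have "{u \<in> V. c u = c v} \<in> P" using True cP by (auto simp: classes_def)
          hence "cls v = {u \<in> V. c u = c v}" using True by (intro cls_eq) auto
          thus ?thesis using rep[OF cls(1)[OF True]] True cls(1)[OF True] by (simp add: G_def H_def)
        qed (use ext in \<open>auto simp: G_def\<close>)
      qed
    qed
    show "G ` ?I \<subseteq> ?C"
    proof (rule image_subsetI)
      fix f assume "f \<in> ?I"
      hence f: "f \<in> P \<rightarrow>\<^sub>E {..<q}" and inj: "inj_on f P" by auto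
      have "f ` P = {..<q}"
        using f card_image[OF inj] P(2) by (intro card_subset_eq) auto
      hence im: "G f ` V = {..<q}" using clsV by (simp add: G_def image_image[symmetric])
      have "G f \<in> V \<rightarrow>\<^sub>E {..<q}" using im by (auto simp: G_def PiE_iff extensional_def)
      hence col: "G f \<in> colourings q V" using im by (simp add: colourings_def)
      have "{u \<in> V. G f u = G f v} = cls v" if v: "v \<in> V" for v
      proof -
        have "G f u = G f v \<longleftrightarrow> cls u = cls v" if "u \<in> V" for u
          using that v cls(1) inj by (auto simp: G_def inj_on_eq_iff)
        thus ?thesis using cls cls_eq v UP by blast
      qed
      hence "classes V (G f) = P" unfolding classes_def clsV[symmetric] by (intro image_cong) auto
      thus "G f \<in> ?C" using col by simp
    qed
    show "H ` ?C \<subseteq> ?I"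
    proof (rule image_subsetI)
      fix c assume "c \<in> ?C"
      hence c: "c \<in> colourings q V" "P = classes V c" by auto
      have "c (rep A) < q" if "A \<in> P" for A
        using c(1) repV[OF that] by (auto simp: colourings_def)
      hence 1: "H c \<in> P \<rightarrow>\<^sub>E {..<q}" by (auto simp: H_def)
      have 2: "inj_on (H c) P"
      proof (rule inj_onI)
        fix A B assume AB: "A \<in> P" "B \<in> P" "H c A = H c B"
        hence "c (rep A) = c (rep B)" by (simp add: H_def)
        hence "rep A \<in> {u \<in> V. c u = c (rep A)}" "rep B \<in> {u \<in> V. c u = c (rep A)}"
          "{u \<in> V. c u = c (rep A)} \<in> P"
          using repV AB c(2) by (auto simp: classes_def)
        thus "A = B" using uniq rep AB by metis
      qed
      show "H c \<in> ?I" using 1 2 by simp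
    qed
  qed
  hence "card ?C = card ?I" by (simp add: bij_betw_same_card)
  also have "\<dots> = fact q" using P(2) finP by (subst card_injections_PiE) auto
  finally show ?thesis .
qed

text \<open>The tuples are sorted by the sequence of partitions they induce. Injective sequences of
  divisible partitions give \<open>fact k\<close> times the binomial coefficient, and each part
  sequence is coloured in \<open>fact q ^ k\<close> ways. This is how a factorial moment becomes a
  sum over tuples of colourings.\<close>

lemma card_colouring_tuples:
  assumes V: "finite V" and E: "E \<subseteq> [V]\<^bsup>2\<^esup>"
  shows "card {c \<in> {..<k} \<rightarrow>\<^sub>E colourings q V. inj_on (\<lambda>j. classes V (c j)) {..<k} \<and> (\<forall>j<k. balanced q V E (c j))}
       = fact q ^ k * (fact k * (card (divisible_partitions q V E) choose k))"
proof -
  let ?D = "divisible_partitions q V E"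
  let ?F = "{f \<in> {..<k} \<rightarrow>\<^sub>E ?D. inj_on f {..<k}}"
  define fib where "fib P = {c \<in> colourings q V. classes V c = P}" for P
  have finD: "finite ?D"
    by (rule finite_subset[of _ "Pow (Pow V)"]) (use V in \<open>auto simp: divisible_partitions_def partition_on_def\<close>)
  have fincol: "finite (colourings q V)"
    using V by (simp add: colourings_def finite_PiE)
  have finfib: "finite (fib P)" for P using fincol by (simp add: fib_def)
  have "{c \<in> {..<k} \<rightarrow>\<^sub>E colourings q V. inj_on (\<lambda>j. classes V (c j)) {..<k} \<and> (\<forall>j<k. balanced q V E (c j))}
      = (\<Union>f\<in>?F. PiE {..<k} (\<lambda>j. fib (f j)))" (is "?L = ?R")
  proof (intro equalityI subsetI)
    fix c assume c: "c \<in> ?L"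
    define f where "f = (\<lambda>j\<in>{..<k}. classes V (c j))"
    have col: "c j \<in> colourings q V" if "j < k" for j using c that by auto
    have "f \<in> {..<k} \<rightarrow>\<^sub>E ?D"
      using c classes_in_divisible_partitions[OF E col] by (auto simp: f_def)
    moreover have "inj_on f {..<k}" using c by (auto simp: f_def inj_on_def)
    moreover have "c \<in> PiE {..<k} (\<lambda>j. fib (f j))" using c by (auto simp: f_def fib_def PiE_iff)
    ultimately show "c \<in> ?R" by blast
  next
    fix c assume "c \<in> ?R"
    then obtain f where f: "f \<in> {..<k} \<rightarrow>\<^sub>E ?D" "inj_on f {..<k}" "c \<in> PiE {..<k} (\<lambda>j. fib (f j))" by blast
    have cj: "c j \<in> colourings q V" "classes V (c j) = f j" if "j < k" for j
      using f(3) that by (auto simp: fib_def PiE_iff)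
    have "balanced q V E (c j)" if "j < k" for j
      using classes_in_divisible_partitions[OF E cj(1)[OF that]] cj(2)[OF that] f(1) that by auto
    moreover have "inj_on (\<lambda>j. classes V (c j)) {..<k}" using f(2) cj(2) by (simp add: inj_on_def)
    ultimately show "c \<in> ?L" using f(3) cj(1) by (auto simp: PiE_iff)
  qed
  also have "card ?R = (\<Sum>f\<in>?F. card (PiE {..<k} (\<lambda>j. fib (f j))))"
  proof (rule card_UN_disjoint)
    show "finite ?F" using finD by (simp add: finite_PiE)
    show "\<forall>f\<in>?F. finite (PiE {..<k} (\<lambda>j. fib (f j)))" using finfib by (auto intro!: finite_PiE)
    show "\<forall>f\<in>?F. \<forall>g\<in>?F. f \<noteq> g \<longrightarrow> PiE {..<k} (\<lambda>j. fib (f j)) \<inter> PiE {..<k} (\<lambda>j. fib (g j)) = {}"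
    proof (intro ballI impI equals0I)
      fix f g c assume fg: "f \<in> ?F" "g \<in> ?F" "f \<noteq> g" and c: "c \<in> PiE {..<k} (\<lambda>j. fib (f j)) \<inter> PiE {..<k} (\<lambda>j. fib (g j))"
      have "f j = g j" if "j < k" for j using c that by (auto simp: fib_def PiE_iff)
      hence "f = g" using fg by (intro PiE_ext[of f "{..<k}" "\<lambda>_. ?D" g]) auto
      thus False using fg by simp
    qed
  qed
  also have "\<dots> = (\<Sum>f\<in>?F. fact q ^ k)"
  proof (rule sum.cong[OF refl])
    fix f assume "f \<in> ?F"
    hence "card (fib (f j)) = fact q" if "j < k" for j
      unfolding fib_def using that by (intro card_colourings_with_classes V) (auto simp: divisible_partitions_def PiE_iff)
    thus "card (PiE {..<k} (\<lambda>j. fib (f j))) = fact q ^ k" by (simp add: card_PiE)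
  qed
  also have "\<dots> = card ?F * fact q ^ k" by simp
  also have "card ?F = fact k * (card ?D choose k)" using finD by (subst card_injections_PiE) auto
  finally show ?thesis by (simp only: mult_ac)
qed

lemma binomial_random_graph_half:
  "binomial_random_graph n (1 / 2) = pmf_of_set (Pow ([{1..n}]\<^bsup>2\<^esup>))"
proof -
  have fin: "finite ([{1..n}]\<^bsup>2\<^esup>)" by (simp add: finite_imp_finite_nsets)
  show ?thesis unfolding binomial_random_graph_def by (rule pmf_of_set_Pow_conv_bernoulli[OF fin])
qed

section \<open>Fourier expansion of the factorial moments\<close>

definition unit_root :: "nat \<Rightarrow> complex" where
  "unit_root q = exp (2 * of_real pi * \<i> / of_nat q)"

text \<open>The average of the factor contributed by one potential edge: 1 if absent and
  \<open>unit_root q ^ phase k s t\<close> if present, each with probability 1/2.\<close>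

definition edge_mean :: "nat \<Rightarrow> nat \<Rightarrow> vtype \<Rightarrow> vtype \<Rightarrow> complex" where
  "edge_mean q k s t = (1 + unit_root q ^ phase k s t) / 2"

lemma unit_root_power: "unit_root q ^ m = exp (2 * of_real pi * \<i> * of_nat m / of_nat q)"
  by (simp add: unit_root_def exp_of_nat_mult[symmetric] mult_ac)

lemma unit_root_power_eq_1: "q > 0 \<Longrightarrow> unit_root q ^ m = 1 \<longleftrightarrow> q dvd m"
  unfolding unit_root_power by (rule complex_root_unity_eq_1) simp

lemma norm_unit_root_power [simp]: "norm (unit_root q ^ m) = 1"
  by (simp add: unit_root_def norm_power)

lemma sum_unit_root_powers:
  assumes "q > 0"
  shows "(\<Sum>a<q. unit_root q ^ (a * d)) = (if q dvd d then of_nat q else 0)"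
proof -
  have eq: "(\<Sum>a<q. unit_root q ^ (a * d)) = (\<Sum>a<q. (unit_root q ^ d) ^ a)"
    by (simp add: power_mult[symmetric] mult.commute)
  show ?thesis
  proof (cases "q dvd d")
    case True
    hence "unit_root q ^ d = 1" using unit_root_power_eq_1[OF assms] by simp
    thus ?thesis unfolding eq using True by simp
  next
    case False
    hence "unit_root q ^ d \<noteq> 1" using unit_root_power_eq_1[OF assms] by simp
    moreover have "(unit_root q ^ d) ^ q = 1"
      unfolding power_mult[symmetric] unit_root_power_eq_1[OF assms] by simp
    ultimately show ?thesis unfolding eq using False by (simp add: geometric_sum)
  qed
qed

lemma norm_mean_with_one:
  fixes z :: complex
  assumes z: "norm z = 1"
  shows "norm ((1 + z) / 2) \<le> 1" and "norm ((1 + z) / 2) = 1 \<Longrightarrow> z = 1"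
proof -
  have "norm (1 + z) \<le> 2" using norm_triangle_ineq[of 1 z] z by simp
  thus "norm ((1 + z) / 2) \<le> 1" by (simp add: norm_divide)
  assume "norm ((1 + z) / 2) = 1"
  hence "(norm (1 + z))\<^sup>2 = 4" by (simp add: norm_divide)
  moreover have z2: "(Re z)\<^sup>2 + (Im z)\<^sup>2 = 1" using z cmod_power2[of z] by simp
  ultimately have "(1 + Re z)\<^sup>2 + (Im z)\<^sup>2 = 4" using cmod_power2[of "1 + z"] by simp
  hence "1 + 2 * Re z + ((Re z)\<^sup>2 + (Im z)\<^sup>2) = 4" by (simp add: power2_eq_square algebra_simps)
  hence "Re z = 1" using z2 by simp
  moreover from this z2 have "Im z = 0" by simp
  ultimately show "z = 1" by (simp add: complex_eq_iff)
qed

lemma edge_mean_eq_1: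
  assumes "q > 0"
  shows "edge_mean q k s t = 1 \<longleftrightarrow> q dvd phase k s t"
proof -
  have "edge_mean q k s t = 1 \<longleftrightarrow> unit_root q ^ phase k s t = 1"
    unfolding edge_mean_def by (auto simp: field_simps)
  thus ?thesis using unit_root_power_eq_1[OF assms] by simp
qed

lemma edge_weight_edge_mean:
  assumes "q > 0"
  shows "edge_weight (tuples q k \<times> tuples q k) (edge_mean q k) (q ^ k)"
proof
  show "norm (edge_mean q k s t) \<le> 1" for s t
    unfolding edge_mean_def by (rule norm_mean_with_one) simp
  show "edge_mean q k s t = 1" if "norm (edge_mean q k s t) = 1" for s t
    using norm_mean_with_one(2)[OF norm_unit_root_power that[unfolded edge_mean_def]]
    by (simp add: edge_mean_def)
  show "edge_mean q k s t = edge_mean q k t s" for s t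
    by (simp add: edge_mean_def phase_commute[of k s t])
  show "card L \<le> q ^ k" if "L \<subseteq> tuples q k \<times> tuples q k" "\<forall>s\<in>L. \<forall>t\<in>L. edge_mean q k s t = 1" for L
    using that by (intro card_clique_le) (auto simp: edge_mean_eq_1[OF assms])
  show "\<exists>s\<in>L. edge_mean q k t s \<noteq> 1"
    if "L \<subseteq> tuples q k \<times> tuples q k" "\<forall>s\<in>L. \<forall>t\<in>L. edge_mean q k s t = 1" "card L = q ^ k"
      "t \<in> tuples q k \<times> tuples q k - L" for L t
    using maximum_clique_dominates[of L q k t] that by (auto simp: edge_mean_eq_1[OF assms])
qed (use assms in auto)

text \<open>Orthogonality of characters writes \<open>q\<close> times the indicator of each
  divisibility condition as a sum over one frequency. Multiplying out over all vertices and
  colourings attaches a frequency vector \<open>x v\<close> to every vertex.\<close>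

lemma balanced_Fourier:
  assumes q: "q > 0" and V: "finite V"
  shows "of_bool (\<forall>j<k. balanced q V E (c j)) * of_nat (q ^ k) ^ card V
    = (\<Sum>x\<in>V \<rightarrow>\<^sub>E tuples q k. \<Prod>v\<in>V. \<Prod>j<k. unit_root q ^ (x v j * card {e \<in> E. v \<in> e \<and> mono_edge (c j) e}))"
proof -
  let ?D = "\<lambda>v j. card {e \<in> E. v \<in> e \<and> mono_edge (c j) e}"
  have "(\<Sum>x\<in>V \<rightarrow>\<^sub>E tuples q k. \<Prod>v\<in>V. \<Prod>j<k. unit_root q ^ (x v j * ?D v j))
      = (\<Prod>v\<in>V. \<Sum>g\<in>tuples q k. \<Prod>j<k. unit_root q ^ (g j * ?D v j))"
    using V by (subst prod_sum_PiE) auto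
  also have "\<dots> = (\<Prod>v\<in>V. \<Prod>j<k. \<Sum>a<q. unit_root q ^ (a * ?D v j))"
    unfolding tuples_def by (subst prod_sum_PiE) auto
  also have "\<dots> = (\<Prod>v\<in>V. \<Prod>j<k. if q dvd ?D v j then of_nat q else 0)"
    by (simp only: sum_unit_root_powers[OF q])
  also have "\<dots> = of_bool (\<forall>j<k. balanced q V E (c j)) * of_nat (q ^ k) ^ card V"
  proof (cases "\<forall>j<k. balanced q V E (c j)")
    case True
    hence "(\<Prod>v\<in>V. \<Prod>j<k. if q dvd ?D v j then of_nat q else 0) = (\<Prod>v\<in>V. \<Prod>j<k. (of_nat q :: complex))"
      by (intro prod.cong refl) (auto simp: balanced_def)
    thus ?thesis using True by simp
  next
    case False
    then obtain j v where jv: "j < k" "v \<in> V" "\<not> q dvd ?D v j" by (auto simp: balanced_def)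
    have "(\<Prod>j<k. if q dvd ?D v j then of_nat q else (0::complex)) = 0"
      using jv by (intro prod_zero bexI[of _ j]) auto
    hence "(\<Prod>v\<in>V. \<Prod>j<k. if q dvd ?D v j then of_nat q else (0::complex)) = 0"
      using V jv by (intro prod_zero bexI[of _ v]) auto
    thus ?thesis using False by simp
  qed
  finally show ?thesis ..
qed

text \<open>The analogue of \<open>phase\<close> while colours and frequencies are still separate
  functions.\<close>

definition edge_phase :: "nat \<Rightarrow> (nat \<Rightarrow> 'a \<Rightarrow> nat) \<Rightarrow> ('a \<Rightarrow> nat \<Rightarrow> nat) \<Rightarrow> 'a set \<Rightarrow> nat" where
  "edge_phase k c x e = (\<Sum>j | j < k \<and> mono_edge (c j) e. \<Sum>v\<in>e. x v j)"

text \<open>Double counting: the exponent is a sum over incidences of a vertex with a monochromatic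
  edge, regrouped by edges.\<close>

lemma vertex_phases_to_edges:
  assumes V: "finite V" and E: "E \<subseteq> [V]\<^bsup>2\<^esup>"
  shows "(\<Prod>v\<in>V. \<Prod>j<k. w ^ (x v j * card {e \<in> E. v \<in> e \<and> mono_edge (c j) e})) = (\<Prod>e\<in>E. (w :: complex) ^ edge_phase k c x e)"
proof -
  have finE: "finite E" using E V by (meson finite_imp_finite_nsets finite_subset)
  have D: "card {e \<in> E. v \<in> e \<and> mono_edge (c j) e} = (\<Sum>e\<in>E. of_bool (v \<in> e) * of_bool (mono_edge (c j) e))" for v j
    using finE by (simp add: of_bool_conj[symmetric] Int_def)
  have "(\<Sum>v\<in>V. \<Sum>j<k. x v j * card {e \<in> E. v \<in> e \<and> mono_edge (c j) e})
      = (\<Sum>v\<in>V. \<Sum>j<k. \<Sum>e\<in>E. of_bool (mono_edge (c j) e) * (of_bool (v \<in> e) * x v j))"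
    unfolding D by (simp add: sum_distrib_left mult_ac)
  also have "\<dots> = (\<Sum>v\<in>V. \<Sum>e\<in>E. \<Sum>j<k. of_bool (mono_edge (c j) e) * (of_bool (v \<in> e) * x v j))"
    by (intro sum.cong refl sum.swap)
  also have "\<dots> = (\<Sum>e\<in>E. \<Sum>v\<in>V. \<Sum>j<k. of_bool (mono_edge (c j) e) * (of_bool (v \<in> e) * x v j))"
    by (rule sum.swap)
  also have "\<dots> = (\<Sum>e\<in>E. edge_phase k c x e)"
  proof (rule sum.cong[OF refl])
    fix e assume "e \<in> E"
    hence e: "e \<subseteq> V" using E by (auto simp: nsets_def)
    have "(\<Sum>v\<in>V. of_bool (v \<in> e) * x v j) = (\<Sum>v\<in>e. x v j)" for j
      by (rule sum.mono_neutral_cong_right) (use V e in auto)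
    hence "(\<Sum>v\<in>V. \<Sum>j<k. of_bool (mono_edge (c j) e) * (of_bool (v \<in> e) * x v j))
        = (\<Sum>j<k. of_bool (mono_edge (c j) e) * (\<Sum>v\<in>e. x v j))"
      by (subst sum.swap) (simp add: sum_distrib_left[symmetric])
    also have "\<dots> = edge_phase k c x e"
      unfolding edge_phase_def by (rule sum.mono_neutral_cong_right) auto
    finally show "(\<Sum>v\<in>V. \<Sum>j<k. of_bool (mono_edge (c j) e) * (of_bool (v \<in> e) * x v j)) = edge_phase k c x e" .
  qed
  finally have eq: "(\<Sum>v\<in>V. \<Sum>j<k. x v j * card {e \<in> E. v \<in> e \<and> mono_edge (c j) e}) = (\<Sum>e\<in>E. edge_phase k c x e)" .
  show ?thesis unfolding power_sum[symmetric] eq ..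
qed

text \<open>Once the phases sit on edges, summing over all edge sets expands a product with one
  factor per potential edge.\<close>

lemma balanced_graphs_sum:
  assumes q: "q > 0" and V: "finite V"
  shows "(\<Sum>E\<in>Pow ([V]\<^bsup>2\<^esup>). of_bool (\<forall>j<k. balanced q V E (c j))) * of_nat (q ^ k) ^ card V
    = (\<Sum>x\<in>V \<rightarrow>\<^sub>E tuples q k. \<Prod>e\<in>[V]\<^bsup>2\<^esup>. 1 + unit_root q ^ edge_phase k c x e)"
proof -
  have fin: "finite ([V]\<^bsup>2\<^esup>)" using V by (simp add: finite_imp_finite_nsets)
  have "(\<Sum>E\<in>Pow ([V]\<^bsup>2\<^esup>). of_bool (\<forall>j<k. balanced q V E (c j))) * of_nat (q ^ k) ^ card V
      = (\<Sum>E\<in>Pow ([V]\<^bsup>2\<^esup>). \<Sum>x\<in>V \<rightarrow>\<^sub>E tuples q k. \<Prod>e\<in>E. unit_root q ^ edge_phase k c x e)"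
    unfolding sum_distrib_right balanced_Fourier[OF q V]
    by (intro sum.cong refl vertex_phases_to_edges[OF V]) auto
  also have "\<dots> = (\<Sum>x\<in>V \<rightarrow>\<^sub>E tuples q k. \<Sum>E\<in>Pow ([V]\<^bsup>2\<^esup>). \<Prod>e\<in>E. unit_root q ^ edge_phase k c x e)"
    by (rule sum.swap)
  also have "\<dots> = (\<Sum>x\<in>V \<rightarrow>\<^sub>E tuples q k. \<Prod>e\<in>[V]\<^bsup>2\<^esup>. unit_root q ^ edge_phase k c x e + 1)"
    by (simp add: prod_add[OF fin])
  finally show ?thesis by (simp add: add.commute)
qed

lemma prod_nsets_2:
  fixes n :: nat
  shows "(\<Prod>e\<in>[{1..n}]\<^bsup>2\<^esup>. f e) = (\<Prod>(u, v)\<in>{(u, v). u \<in> {1..n} \<and> v \<in> {1..n} \<and> u < v}. f {u, v})"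
proof -
  have "bij_betw (\<lambda>(u, v). {u, v}) {(u, v). u \<in> {1..n} \<and> v \<in> {1..n} \<and> u < v} ([{1..n}]\<^bsup>2\<^esup>)"
    unfolding bij_betw_def
  proof
    show "inj_on (\<lambda>(u, v). {u, v}) {(u, v). u \<in> {1..n} \<and> v \<in> {1..n} \<and> u < v}"
      by (auto simp: inj_on_def doubleton_eq_iff)
    show "(\<lambda>(u, v). {u, v}) ` {(u, v). u \<in> {1..n} \<and> v \<in> {1..n} \<and> u < v} = [{1..n}]\<^bsup>2\<^esup>"
    proof (intro equalityI subsetI)
      fix e assume "e \<in> [{1..n}]\<^bsup>2\<^esup>"
      then obtain u v where uv: "e = {u, v}" "u \<in> {1..n}" "v \<in> {1..n}" "u \<noteq> v"
        by (elim nsets2_E)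
      have "e = {min u v, max u v}" using uv(1) by (auto simp: min_def max_def)
      moreover have "(min u v, max u v) \<in> {(u, v). u \<in> {1..n} \<and> v \<in> {1..n} \<and> u < v}"
        using uv by (auto simp: min_def max_def)
      ultimately show "e \<in> (\<lambda>(u, v). {u, v}) ` {(u, v). u \<in> {1..n} \<and> v \<in> {1..n} \<and> u < v}"
        by (metis (mono_tags, lifting) case_prod_conv image_eqI)
    qed auto
  qed
  from prod.reindex_bij_betw[OF this, of f] show ?thesis by (simp add: case_prod_unfold)
qed

section \<open>From colourings and frequencies to vertex types\<close>

definition colour_of :: "nat \<Rightarrow> (nat \<Rightarrow> vtype) \<Rightarrow> nat \<Rightarrow> nat \<Rightarrow> nat" where
  "colour_of n \<tau> j = (\<lambda>v\<in>{1..n}. fst (\<tau> v) j)"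

text \<open>The assignments that come from \<open>k\<close> surjective colourings with pairwise
  distinct partitions; only these occur in the factorial moment.\<close>

definition admissible :: "nat \<Rightarrow> nat \<Rightarrow> nat \<Rightarrow> (nat \<Rightarrow> vtype) \<Rightarrow> bool" where
  "admissible q k n \<tau> \<longleftrightarrow> (\<forall>j<k. colour_of n \<tau> j \<in> colourings q {1..n}) \<and>
     inj_on (\<lambda>j. classes {1..n} (colour_of n \<tau> j)) {..<k}"

lemma pair_weight_eq_prod_edges:
  assumes c: "\<And>v j. v \<in> {1..n} \<Longrightarrow> j < k \<Longrightarrow> fst (\<tau> v) j = c j v"
    and x: "\<And>v j. v \<in> {1..n} \<Longrightarrow> j < k \<Longrightarrow> snd (\<tau> v) j = x v j"
  shows "pair_weight (edge_mean q k) n \<tau> = (\<Prod>e\<in>[{1..n}]\<^bsup>2\<^esup>. (1 + unit_root q ^ edge_phase k c x e) / 2)"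
  unfolding prod_nsets_2 pair_weight_def
proof (rule prod.cong[OF refl], clarify)
  fix u v assume uv: "u \<in> {1..n}" "v \<in> {1..n}" "u < v"
  have "agree k (fst (\<tau> u)) (fst (\<tau> v)) = {j. j < k \<and> mono_edge (c j) {u, v}}"
    using uv c by (auto simp: agree_def mono_edge_def)
  hence "phase k (\<tau> u) (\<tau> v) = edge_phase k c x {u, v}"
    unfolding phase_def edge_phase_def using uv x by (intro sum.cong) auto
  thus "edge_mean q k (\<tau> u) (\<tau> v) = (1 + unit_root q ^ edge_phase k c x {u, v}) / 2"
    by (simp add: edge_mean_def)
qed

text \<open>At edge probability 1/2 the graph is uniform on all edge sets. The moment is rewritten
  through tuples of colourings, the sum over graphs is evaluated by the character expansion, and the
  normalisation \<open>2 ^ card ?F\<close> is distributed over the edges, giving the halves in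
  \<open>edge_mean\<close>.\<close>

lemma factorial_moment_formula:
  assumes q: "q > 0"
  shows "complex_of_real (measure_pmf.expectation (binomial_random_graph n (1 / 2))
            (\<lambda>E. real (num_divisible_partitions q n E choose k)))
       = (\<Sum>\<tau> | \<tau> \<in> {1..n} \<rightarrow>\<^sub>E (tuples q k \<times> tuples q k) \<and> admissible q k n \<tau>. pair_weight (edge_mean q k) n \<tau>)
           / of_nat (q ^ k) ^ n / (fact q ^ k * fact k)"
proof -
  let ?V = "{1..n}" and ?F = "[{1..n}]\<^bsup>2\<^esup>"
  let ?C = "{c \<in> {..<k} \<rightarrow>\<^sub>E colourings q ?V. inj_on (\<lambda>j. classes ?V (c j)) {..<k}}"
  let ?X = "?V \<rightarrow>\<^sub>E tuples q k"
  have finF: "finite ?F" by (simp add: finite_imp_finite_nsets)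
  have finC: "finite ?C" by (simp add: colourings_def finite_PiE)
  have cnt: "(fact q ^ k * fact k :: complex) * of_nat (num_divisible_partitions q n E choose k)
      = (\<Sum>c\<in>?C. of_bool (\<forall>j<k. balanced q ?V E (c j)))" if "E \<in> Pow ?F" for E
  proof -
    have "(\<Sum>c\<in>?C. of_bool (\<forall>j<k. balanced q ?V E (c j)))
        = (of_nat (card {c \<in> ?C. \<forall>j<k. balanced q ?V E (c j)}) :: complex)"
      using finC by (simp add: Int_def)
    also have "{c \<in> ?C. \<forall>j<k. balanced q ?V E (c j)} =
        {c \<in> {..<k} \<rightarrow>\<^sub>E colourings q ?V. inj_on (\<lambda>j. classes ?V (c j)) {..<k} \<and> (\<forall>j<k. balanced q ?V E (c j))}"
      by blast
    also have "card \<dots> = fact q ^ k * (fact k * (num_divisible_partitions q n E choose k))"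
      unfolding num_divisible_partitions_def using that by (intro card_colouring_tuples) auto
    finally show ?thesis by (simp add: mult.assoc)
  qed
  have "complex_of_real (measure_pmf.expectation (binomial_random_graph n (1 / 2))
            (\<lambda>E. real (num_divisible_partitions q n E choose k)))
      = (\<Sum>E\<in>Pow ?F. of_nat (num_divisible_partitions q n E choose k)) / 2 ^ card ?F"
    unfolding binomial_random_graph_half using finF
    by (subst integral_pmf_of_set) (auto simp: card_Pow)
  hence "complex_of_real (measure_pmf.expectation (binomial_random_graph n (1 / 2))
            (\<lambda>E. real (num_divisible_partitions q n E choose k))) * (fact q ^ k * fact k)
      = (\<Sum>E\<in>Pow ?F. (fact q ^ k * fact k) * of_nat (num_divisible_partitions q n E choose k)) / 2 ^ card ?F"
    by (simp add: sum_distrib_left[symmetric])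
  also have "\<dots> = (\<Sum>c\<in>?C. \<Sum>E\<in>Pow ?F. of_bool (\<forall>j<k. balanced q ?V E (c j))) / 2 ^ card ?F"
    by (subst sum.swap) (intro arg_cong2[where f = "(/)"] sum.cong refl cnt)
  finally have 1: "complex_of_real (measure_pmf.expectation (binomial_random_graph n (1 / 2))
            (\<lambda>E. real (num_divisible_partitions q n E choose k))) * (fact q ^ k * fact k) * of_nat (q ^ k) ^ n
      = (\<Sum>c\<in>?C. (\<Sum>E\<in>Pow ?F. of_bool (\<forall>j<k. balanced q ?V E (c j))) * of_nat (q ^ k) ^ card ?V) / 2 ^ card ?F"
    by (simp add: sum_distrib_right)
  also have "\<dots> = (\<Sum>c\<in>?C. \<Sum>x\<in>?X. \<Prod>e\<in>?F. (1 + unit_root q ^ edge_phase k c x e) / 2)"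
    unfolding balanced_graphs_sum[OF q finite_atLeastAtMost] by (simp add: sum_divide_distrib prod_dividef)
  also have "\<dots> = (\<Sum>(c, x)\<in>?C \<times> ?X. \<Prod>e\<in>?F. (1 + unit_root q ^ edge_phase k c x e) / 2)"
    by (rule sum.cartesian_product)
  \<comment> \<open>The bijection is a transposition: \<open>c\<close> lists the colourings one by
    one, while a type collects all colours and frequencies of a single vertex.\<close>
  also have "\<dots> = (\<Sum>\<tau> | \<tau> \<in> ?V \<rightarrow>\<^sub>E (tuples q k \<times> tuples q k) \<and> admissible q k n \<tau>. pair_weight (edge_mean q k) n \<tau>)"
  proof (rule sum.reindex_bij_witness[of _ "\<lambda>\<tau>. (\<lambda>j\<in>{..<k}. colour_of n \<tau> j, \<lambda>v\<in>?V. snd (\<tau> v))"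
        "\<lambda>(c, x). \<lambda>v\<in>?V. (\<lambda>j\<in>{..<k}. c j v, x v)"], goal_cases)
    case (1 a)
    then obtain c x where a: "a = (c, x)" and c: "c \<in> {..<k} \<rightarrow>\<^sub>E colourings q ?V" and x: "x \<in> ?X" by auto
    have cj: "c j \<in> ?V \<rightarrow>\<^sub>E {..<q}" if "j < k" for j using c that by (auto simp: colourings_def)
    have "colour_of n (\<lambda>v\<in>?V. (\<lambda>j\<in>{..<k}. c j v, x v)) j = c j" if "j < k" for j
      using that PiE_arb[OF cj[OF that]] by (auto simp: colour_of_def fun_eq_iff)
    hence "(\<lambda>j\<in>{..<k}. colour_of n (\<lambda>v\<in>?V. (\<lambda>j\<in>{..<k}. c j v, x v)) j) = c"
      using PiE_arb[OF c] by (auto simp: fun_eq_iff)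
    moreover have "(\<lambda>v\<in>?V. snd ((\<lambda>v\<in>?V. (\<lambda>j\<in>{..<k}. c j v, x v)) v)) = x"
      using PiE_arb[OF x] by (auto simp: fun_eq_iff)
    ultimately show ?case using a by simp
  next
    case (2 a)
    then obtain c x where a: "a = (c, x)" and c: "c \<in> {..<k} \<rightarrow>\<^sub>E colourings q ?V" and x: "x \<in> ?X"
      and inj: "inj_on (\<lambda>j. classes ?V (c j)) {..<k}" by auto
    let ?t = "\<lambda>v\<in>?V. (\<lambda>j\<in>{..<k}. c j v, x v)"
    have cj: "c j \<in> ?V \<rightarrow>\<^sub>E {..<q}" if "j < k" for j using c that by (auto simp: colourings_def)
    have col: "colour_of n ?t j = c j" if "j < k" for j
      using that PiE_arb[OF cj[OF that]] by (auto simp: colour_of_def fun_eq_iff)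
    have "admissible q k n ?t"
      unfolding admissible_def using col c inj by (auto simp: inj_on_def)
    moreover have "(\<lambda>j\<in>{..<k}. c j v) \<in> tuples q k" if "v \<in> ?V" for v
      unfolding tuples_def using PiE_mem[OF cj that] by (intro PiE_I) auto
    hence "?t \<in> ?V \<rightarrow>\<^sub>E (tuples q k \<times> tuples q k)" using x by (auto simp: PiE_iff)
    ultimately show ?case using a by simp
  next
    case (3 \<tau>)
    hence \<tau>: "\<tau> \<in> ?V \<rightarrow>\<^sub>E (tuples q k \<times> tuples q k)" by simp
    show ?case
    proof
      fix v
      show "(case (\<lambda>j\<in>{..<k}. colour_of n \<tau> j, \<lambda>v\<in>?V. snd (\<tau> v)) of (c, x) \<Rightarrow> \<lambda>v\<in>?V. (\<lambda>j\<in>{..<k}. c j v, x v)) v = \<tau> v"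
      proof (cases "v \<in> ?V")
        case True
        hence "fst (\<tau> v) \<in> tuples q k" using PiE_mem[OF \<tau> True] by (simp only: mem_Times_iff)
        hence "(\<lambda>j\<in>{..<k}. fst (\<tau> v) j) = fst (\<tau> v)"
          unfolding tuples_def PiE_def by (intro extensional_restrict) blast
        moreover have "(\<lambda>j\<in>{..<k}. (\<lambda>j\<in>{..<k}. colour_of n \<tau> j) j v) = (\<lambda>j\<in>{..<k}. fst (\<tau> v) j)"
          using True by (auto simp: colour_of_def fun_eq_iff)
        ultimately show ?thesis using True by simp
      qed (use PiE_arb[OF \<tau>] in auto)
    qed
  next
    case (4 \<tau>)
    hence \<tau>: "\<tau> \<in> ?V \<rightarrow>\<^sub>E (tuples q k \<times> tuples q k)" and adm: "admissible q k n \<tau>" by auto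
    have "inj_on (\<lambda>j. classes ?V ((\<lambda>j\<in>{..<k}. colour_of n \<tau> j) j)) {..<k}"
      using adm by (simp add: admissible_def inj_on_def)
    moreover have "(\<lambda>v\<in>?V. snd (\<tau> v)) \<in> ?X" using PiE_mem[OF \<tau>] by (auto simp: mem_Times_iff)
    moreover have "(\<lambda>j\<in>{..<k}. colour_of n \<tau> j) \<in> {..<k} \<rightarrow>\<^sub>E colourings q ?V"
      using adm by (auto simp: admissible_def)
    ultimately show ?case by simp
  next
    case (5 a)
    obtain c x where a: "a = (c, x)" by force
    have "pair_weight (edge_mean q k) n (\<lambda>v\<in>?V. (\<lambda>j\<in>{..<k}. c j v, x v))
        = (\<Prod>e\<in>?F. (1 + unit_root q ^ edge_phase k c x e) / 2)"
      by (rule pair_weight_eq_prod_edges) auto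
    thus ?case using a by simp
  qed
  finally show ?thesis using q by (simp add: field_simps)
qed

section \<open>The limit of the factorial moments and the conclusion\<close>

text \<open>Distinctness of the partitions translates directly into \<open>resolving\<close>.
  Surjectivity of each colouring then comes for free, because the colour vectors of a resolving
  maximum clique exhaust \<open>tuples q k\<close>.\<close>

lemma admissible_iff_resolving:
  assumes q: "q \<ge> 3" and \<tau>: "\<tau> ` {1..n} \<subseteq> tuples q k \<times> tuples q k"
    and cl: "\<And>s t. s \<in> \<tau> ` {1..n} \<Longrightarrow> t \<in> \<tau> ` {1..n} \<Longrightarrow> q dvd phase k s t"
    and card: "card (\<tau> ` {1..n}) = q ^ k"
  shows "admissible q k n \<tau> \<longleftrightarrow> resolving k (\<tau> ` {1..n})"
proof -
  have "inj_on (\<lambda>j. classes {1..n} (colour_of n \<tau> j)) {..<k} \<longleftrightarrow> resolving k (\<tau> ` {1..n})"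
    unfolding inj_on_def resolving_def classes_eq_iff by (simp add: colour_of_def) blast
  moreover have "colour_of n \<tau> j \<in> colourings q {1..n}" if res: "resolving k (\<tau> ` {1..n})" and j: "j < k" for j
  proof -
    have surj: "fst ` (\<tau> ` {1..n}) = tuples q k"
      using resolving_projection[OF q clique_separated[OF cl] \<tau> card res] by (simp add: bij_betw_def)
    have "fst (\<tau> v) j < q" if "v \<in> {1..n}" for v
      using surj that by (intro tuples_lt[OF _ j]) auto
    moreover have "a \<in> colour_of n \<tau> j ` {1..n}" if a: "a < q" for a
    proof -
      have "(\<lambda>i\<in>{..<k}. a) \<in> fst ` (\<tau> ` {1..n})" unfolding surj using a by (auto simp: tuples_def)
      then obtain v where v: "v \<in> {1..n}" "(\<lambda>i\<in>{..<k}. a) = fst (\<tau> v)" by auto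
      have "colour_of n \<tau> j v = a" using v(1) j fun_cong[OF v(2), of j] by (simp add: colour_of_def)
      thus ?thesis using v(1) by blast
    qed
    ultimately show ?thesis unfolding colourings_def by (auto simp: colour_of_def)
  qed
  ultimately show ?thesis unfolding admissible_def by blast
qed

text \<open>The weighted count tends to the number of resolving maximum cliques. That number is a
  \<open>k\<close>-th power, as is \<open>fact q ^ k\<close>, so dividing by \<open>fact k\<close>
  as well leaves the factorial moments of a Poisson law.\<close>

lemma factorial_moment_limit:
  assumes q: "q \<ge> 3"
  shows "(\<lambda>n. measure_pmf.expectation (binomial_random_graph n (1 / 2))
            (\<lambda>E. real (num_divisible_partitions q n E choose k)))
         \<longlonglongrightarrow> (real (card {a. a < q \<and> q dvd 2 * a}) ^ q / fact q) ^ k / fact k"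
proof -
  have q0: "q > 0" using q by simp
  interpret edge_weight "tuples q k \<times> tuples q k" "edge_mean q k" "q ^ k"
    by (rule edge_weight_edge_mean[OF q0])
  have mc: "max_cliques = {L. L \<subseteq> tuples q k \<times> tuples q k \<and> (\<forall>s\<in>L. \<forall>t\<in>L. q dvd phase k s t) \<and> card L = q ^ k}"
    unfolding max_cliques_def edge_mean_eq_1[OF q0] ..
  let ?W = "\<lambda>n. \<Sum>\<tau> | \<tau> \<in> {1..n} \<rightarrow>\<^sub>E tuples q k \<times> tuples q k \<and> admissible q k n \<tau>. pair_weight (edge_mean q k) n \<tau>"
  have "(\<lambda>n. ?W n / of_nat (q ^ k) ^ n) \<longlonglongrightarrow> of_nat (card (resolving_cliques q k))"
  proof (rule weighted_count_asymptotics)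
    show "resolving_cliques q k \<subseteq> max_cliques" unfolding mc resolving_cliques_def by blast
    fix n :: nat and \<tau> assume "\<tau> ` {1..n} \<in> max_cliques"
    hence *: "\<tau> ` {1..n} \<subseteq> tuples q k \<times> tuples q k" "card (\<tau> ` {1..n}) = q ^ k"
      and cl: "\<forall>s\<in>\<tau> ` {1..n}. \<forall>t\<in>\<tau> ` {1..n}. q dvd phase k s t" unfolding mc by simp_all
    have "admissible q k n \<tau> \<longleftrightarrow> resolving k (\<tau> ` {1..n})"
      by (rule admissible_iff_resolving[OF q *(1) _ *(2)]) (rule cl[rule_format])
    moreover have "\<tau> ` {1..n} \<in> resolving_cliques q k \<longleftrightarrow> resolving k (\<tau> ` {1..n})"
      unfolding resolving_cliques_def mem_Collect_eq by (rule iffI, (elim conjE, assumption)) (intro conjI * cl)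
    ultimately show "admissible q k n \<tau> \<longleftrightarrow> \<tau> ` {1..n} \<in> resolving_cliques q k" by (rule trans[OF _ sym])
  qed
  hence "(\<lambda>n. ?W n / of_nat (q ^ k) ^ n / (fact q ^ k * fact k))
      \<longlonglongrightarrow> of_nat (card (resolving_cliques q k)) / (fact q ^ k * fact k)"
    by (intro tendsto_divide tendsto_const) auto
  hence "(\<lambda>n. complex_of_real (measure_pmf.expectation (binomial_random_graph n (1 / 2))
            (\<lambda>E. real (num_divisible_partitions q n E choose k))))
      \<longlonglongrightarrow> complex_of_real (real (card (resolving_cliques q k)) / (fact q ^ k * fact k))"
    unfolding factorial_moment_formula[OF q0] by simp
  hence "(\<lambda>n. measure_pmf.expectation (binomial_random_graph n (1 / 2))
            (\<lambda>E. real (num_divisible_partitions q n E choose k)))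
      \<longlonglongrightarrow> real (card (resolving_cliques q k)) / (fact q ^ k * fact k)"
    unfolding tendsto_of_real_iff .
  thus ?thesis unfolding card_resolving_cliques[OF q]
    by (simp add: power_divide power_mult[symmetric] mult.commute)
qed

theorem theorem1p4:
  fixes q :: nat
  assumes "q \<ge> 3"
  shows "(odd q \<longrightarrow>
            converges_in_distribution (\<lambda>n. binomial_random_graph n (1/2))
              (num_divisible_partitions q) (poisson_pmf (1 / fact q))) \<and>
         (even q \<longrightarrow>
            converges_in_distribution (\<lambda>n. binomial_random_graph n (1/2))
              (num_divisible_partitions q) (poisson_pmf (2 ^ q / fact q)))"
proof -
  \<comment> \<open>Each of the \<open>q\<close> colours independently receives a solution of
    \<open>2 a = 0\<close> in the integers modulo \<open>q\<close>; there are two solutions for even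
    \<open>q\<close> and one for odd \<open>q\<close>.\<close>
  define l :: real where "l = real (card {a. a < q \<and> q dvd 2 * a}) ^ q / fact q"
  have l: "l = (if even q then 2 ^ q else 1) / fact q"
    unfolding l_def using assms by (subst card_half_roots) auto
  have conv: "converges_in_distribution (\<lambda>n. binomial_random_graph n (1/2)) (num_divisible_partitions q) (poisson_pmf l)"
  proof (rule converges_in_distribution_poissonI)
    show "finite (set_pmf (binomial_random_graph n (1 / 2)))" for n
      unfolding binomial_random_graph_half
      by (subst set_pmf_of_set) (auto simp: finite_imp_finite_nsets)
    show "l > 0" unfolding l by simp
    show "(\<lambda>n. measure_pmf.expectation (binomial_random_graph n (1 / 2)) (\<lambda>w. real (num_divisible_partitions q n w choose k)))
        \<longlonglongrightarrow> l ^ k / fact k" for k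
      unfolding l_def by (rule factorial_moment_limit[OF assms])
  qed
  have "odd q \<Longrightarrow> l = 1 / fact q" "even q \<Longrightarrow> l = 2 ^ q / fact q" using l by auto
  with conv show ?thesis by metis
qed

end
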